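(* Let $p=p(n)\in[0,1]$, $q:=1-p$, and let $P=P_{\mathcal{B}(n,n,p)}$. (a) If $q=O(1/n)$ and $q=\omega(1/n^2)$, then asymptotically almost surely $\dim P=\Theta(n^2q)$ and $n-\dim P=\Omega(n)$. (b) If $q=\omega(1/n)$ and $q\le n^{-1+1/7}$, then asymptotically almost surely $\dim P=(1-o(1))n$.
   Context: $\mathcal{B}(n,n,p)$ is the random bipartite graph with parts $A=[n]$ and $B=\{n+1,\dots,2n\}$ in which each pair $ij$ with $i\in A$, $j\in B$ is an edge independently with probability $p$. $P_{\mathcal{B}(n,n,p)}$ is the poset on $A\cup B$ in which $i<_P j$ if and only if $i\in A$, $j\in B$ and $ij$ is an edge. The dimension of a poset is the minimum number of linear orders whose intersection is the poset's order. An event holds asymptotically almost surely (a.a.s.) if its probability tends to 1 as $n\to\infty$; Landau notation is as $n\to\infty$. *)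

theory Defs
  imports "HOL-Probability.Probability" "HOL-Library.Landau_Symbols"
begin

(* A partial order on a carrier V is a reflexive relation r, as in HOL.Order_Relation
   (partial_order_on V r, which includes r \<subseteq> V \<times> V).  Realizers are nonempty by convention, so the
   dimension is always at least 1.  The LEAST below is meaningful whenever some finite
   realizer exists, in particular for every finite poset. *)

definition realizer :: "'a set \<Rightarrow> 'a rel \<Rightarrow> 'a rel set \<Rightarrow> bool" where
  "realizer V r L \<longleftrightarrow> L \<noteq> {} \<and> (\<forall>l\<in>L. linear_order_on V l) \<and> \<Inter>L = r"

definition poset_dim :: "'a set \<Rightarrow> 'a rel \<Rightarrow> nat" where
  "poset_dim V r = (LEAST d. \<exists>L. finite L \<and> card L = d \<and> realizer V r L)"

definition part_A :: "nat \<Rightarrow> nat set" where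
  "part_A n = {1..n}"

definition part_B :: "nat \<Rightarrow> nat set" where
  "part_B n = {n + 1..2 * n}"

(* A bipartite graph with parts A and B is represented by its edge set, the edge ij with
   i \<in> A and j \<in> B being the pair (i, j). *)

definition random_bipartite :: "nat \<Rightarrow> real \<Rightarrow> (nat \<times> nat) set pmf" where
  "random_bipartite n p =
     map_pmf (\<lambda>f. {e \<in> part_A n \<times> part_B n. f e})
       (Pi_pmf (part_A n \<times> part_B n) False (\<lambda>_. bernoulli_pmf p))"

definition bip_order :: "nat \<Rightarrow> (nat \<times> nat) set \<Rightarrow> nat rel" where
  "bip_order n E = Id_on (part_A n \<union> part_B n) \<union> {(i, j). i \<in> part_A n \<and> j \<in> part_B n \<and> (i, j) \<in> E}"

definition bip_dim :: "nat \<Rightarrow> (nat \<times> nat) set \<Rightarrow> nat" where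
  "bip_dim n E = poset_dim (part_A n \<union> part_B n) (bip_order n E)"

definition aas :: "(nat \<Rightarrow> 'a pmf) \<Rightarrow> (nat \<Rightarrow> 'a \<Rightarrow> bool) \<Rightarrow> bool" where
  "aas M Q \<longleftrightarrow> (\<lambda>n. measure_pmf.prob (M n) {x. Q n x}) \<longlonglongrightarrow> 1"

end

theory Submission
  imports Defs
begin

text \<open>
  Let \<open>H\<close> be the bipartite graph of non-edges. A realizer is a family of linear extensions, each of which
  reverses a chain subgraph (one without an induced matching of size two) of \<open>H\<close>, and together these
  chain graphs cover \<open>H\<close>. Conversely, one extension for each vertex of \<open>A\<close> that is not isolated in \<open>H\<close>,
  plus two more, form a realizer.

  If \<open>H\<close> has bounded average degree, the second moment method controls the number of edges of \<open>H\<close>,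
  of isolated vertices of \<open>H\<close> in \<open>A\<close>, and of isolated edges of \<open>H\<close>. No two isolated edges lie in a
  common chain graph, which gives the lower bound.

  If the average degree tends to infinity and \<open>q \<le> n powr (- 6 / 7)\<close>, then \<open>H\<close> has only \<open>o(n)\<close> 4-cycles.
  A chain graph without 4-cycles is covered by one vertex on each side, so a realizer of size
  \<open>(1 - \<epsilon>) n\<close> would leave subsets of \<open>A\<close> and \<open>B\<close> of size about \<open>\<epsilon> n\<close> with no edge of \<open>H\<close> between
  them, which a union bound rules out.
\<close>

subsection \<open>Realizers of bipartite posets\<close>

text \<open>Linear extensions are given by numerical keys, injective on \<open>V\<close>, so that
  comparing two vertices becomes arithmetic.\<close>

definition key_order :: "'a set \<Rightarrow> ('a \<Rightarrow> nat) \<Rightarrow> 'a rel" where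
  "key_order V f = {(x, y) \<in> V \<times> V. f x \<le> f y}"

lemma linear_order_on_key_order:
  assumes "inj_on f V"
  shows "linear_order_on V (key_order V f)"
  using assms
  by (auto simp: linear_order_on_def partial_order_on_def preorder_on_def refl_on_def trans_def
      antisym_def total_on_def key_order_def inj_on_def)

lemma linear_order_on_finite_max:
  assumes "linear_order_on V l" "finite S" "S \<noteq> {}" "S \<subseteq> V"
  shows "\<exists>m\<in>S. \<forall>x\<in>S. (x, m) \<in> l"
  using assms(2-4)
proof (induction S rule: finite_ne_induct)
  case (singleton x)
  then show ?case
    using assms(1) by (auto simp: order_on_defs refl_on_def)
next
  case (insert x S)
  then obtain m where m: "m \<in> S" "\<forall>y\<in>S. (y, m) \<in> l" by auto
  have l: "refl_on V l" "trans l" "total_on V l"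
    using assms(1) by (auto simp: order_on_defs)
  have V: "x \<in> V" "m \<in> V" using insert.prems m by auto
  then have "(x, m) \<in> l \<or> (m, x) \<in> l"
    using l(1,3) by (metis refl_onD total_on_def)
  then show ?case
  proof
    assume "(x, m) \<in> l"
    then show ?thesis using m by auto
  next
    assume *: "(m, x) \<in> l"
    then have "\<forall>y\<in>insert x S. (y, x) \<in> l"
      using m l V by (metis insert_iff refl_onD transD)
    then show ?thesis by blast
  qed
qed

lemma linear_order_on_finite_min:
  assumes "linear_order_on V l" "finite S" "S \<noteq> {}" "S \<subseteq> V"
  shows "\<exists>m\<in>S. \<forall>x\<in>S. (m, x) \<in> l"
  using linear_order_on_finite_max[of V "l\<inverse>" S] assms by simp

lemma poset_dim_le:
  assumes "realizer V r L" "finite L" "card L \<le> k"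
  shows "poset_dim V r \<le> k"
proof -
  have "poset_dim V r \<le> card L"
    unfolding poset_dim_def by (rule Least_le) (use assms in blast)
  with assms show ?thesis by simp
qed

text \<open>A \<open>LEAST\<close> says something only once a witness exists, hence the finite
  realizer \<open>L0\<close>; for bipartite posets \<open>bip_realizer\<close> supplies it.\<close>

lemma poset_dim_attained:
  assumes "realizer V r L0" "finite L0"
  obtains L where "realizer V r L" "finite L" "card L = poset_dim V r"
proof -
  have "\<exists>L. finite L \<and> card L = poset_dim V r \<and> realizer V r L"
    unfolding poset_dim_def by (rule LeastI_ex) (use assms in blast)
  with that show thesis by blast
qed

section \<open>Upper bound: a realizer indexed by the vertices with a non-edge\<close>

lemma finite_part [simp]: "finite (part_A n)" "finite (part_B n)"
  and card_part [simp]: "card (part_A n) = n" "card (part_B n) = n"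
  by (auto simp: part_A_def part_B_def)

text \<open>The shift by \<open>2 * n + 1\<close> opens a gap into which \<open>a\<close> is moved:
  above every unshifted vertex and below its own neighbours. Shifted vertices keep their mutual
  order, and so do unshifted ones.\<close>

definition tilt_key :: "nat \<Rightarrow> (nat \<times> nat) set \<Rightarrow> nat \<Rightarrow> nat \<Rightarrow> nat" where
  "tilt_key n E a x =
     (if x = a then 2 * n + 1 else if (a, x) \<in> E then x + 2 * n + 1 else x)"

text \<open>Two orders reverse all pairs inside \<open>A\<close> and inside \<open>B\<close>; for each \<open>a\<close> with a non-edge, one
  further order puts \<open>a\<close> above all elements of \<open>B\<close> that are not adjacent to it.\<close>
lemma bip_realizer:
  assumes "E \<subseteq> part_A n \<times> part_B n"
  defines "S \<equiv> {a \<in> part_A n. \<exists>b\<in>part_B n. (a, b) \<notin> E}"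
  shows "\<exists>L. finite L \<and> card L \<le> card S + 2 \<and>
           realizer (part_A n \<union> part_B n) (bip_order n E) L"
proof -
  let ?V = "part_A n \<union> part_B n"
  \<comment> \<open>\<open>rev\<close> maps \<open>A\<close> decreasingly onto 0..n-1 and
    \<open>B\<close> decreasingly onto n..2n-1: with \<open>id\<close> it makes both parts
    antichains, while \<open>A\<close> stays below \<open>B\<close>.\<close>
  define rev where "rev x = (if x \<le> n then n - x else 3 * n - x)" for x
  define L where "L = {key_order ?V id, key_order ?V rev} \<union> (\<lambda>a. key_order ?V (tilt_key n E a)) ` S"
  have S: "finite S" "S \<subseteq> part_A n" by (auto simp: S_def)
  have fin: "finite L" using S by (auto simp: L_def)
  have "card L \<le> card {key_order ?V id, key_order ?V rev} + card ((\<lambda>a. key_order ?V (tilt_key n E a)) ` S)"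
    unfolding L_def by (rule card_Un_le)
  also have "\<dots> \<le> 2 + card S"
    by (intro add_mono card_image_le S) (simp add: card_insert_if)
  finally have card: "card L \<le> card S + 2" by simp
  have "linear_order_on ?V l" if "l \<in> L" for l
  proof -
    have "inj_on id ?V" by simp
    moreover have "inj_on rev ?V"
      by (auto simp: inj_on_def rev_def part_A_def part_B_def split: if_splits)
    moreover have "inj_on (tilt_key n E a) ?V" for a
    proof (rule inj_onI)
      fix x y assume "x \<in> ?V" "y \<in> ?V" and eq: "tilt_key n E a x = tilt_key n E a y"
      \<comment> \<open>Keys of unshifted vertices other than \<open>a\<close> stay at most
        \<open>2 * n\<close>, and positivity puts shifted ones strictly above
        \<open>2 * n + 1\<close>, so the three ranges are disjoint.\<close>
      then have "1 \<le> x" "x \<le> 2 * n" "1 \<le> y" "y \<le> 2 * n" by (auto simp: part_A_def part_B_def)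
      with eq show "x = y"
        unfolding tilt_key_def by (simp split: if_splits)
    qed
    ultimately show ?thesis
      using that by (auto simp: L_def intro!: linear_order_on_key_order)
  qed
  moreover have "\<Inter>L = bip_order n E"
  proof (intro equalityI subsetI)
    fix z assume z: "z \<in> \<Inter>L"
    obtain x y where [simp]: "z = (x, y)" by (cases z)
    have 1: "(x, y) \<in> key_order ?V id" "(x, y) \<in> key_order ?V rev"
      using z by (auto simp: L_def)
    then have V: "x \<in> ?V" "y \<in> ?V" by (auto simp: key_order_def)
    show "z \<in> bip_order n E"
    proof (cases "x = y")
      case True
      with V show ?thesis by (auto simp: bip_order_def)
    next
      case False
      with 1 have xy: "x \<in> part_A n" "y \<in> part_B n"
        by (auto simp: key_order_def rev_def part_A_def part_B_def split: if_splits)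
      have "(x, y) \<in> E"
      proof (rule ccontr)
        assume *: "(x, y) \<notin> E"
        with xy have "x \<in> S" by (auto simp: S_def)
        with z have "(x, y) \<in> key_order ?V (tilt_key n E x)" by (auto simp: L_def)
        then have "2 * n + 1 \<le> y"
          using * False by (simp add: key_order_def tilt_key_def)
        with xy show False by (simp add: part_B_def)
      qed
      with xy show ?thesis by (auto simp: bip_order_def)
    qed
  next
    fix z assume z: "z \<in> bip_order n E"
    obtain x y where [simp]: "z = (x, y)" by (cases z)
    have "x = y \<and> x \<in> ?V \<or> x \<in> part_A n \<and> y \<in> part_B n \<and> (x, y) \<in> E"
      using z by (auto simp: bip_order_def)
    then show "z \<in> \<Inter>L"
    proof
      assume "x = y \<and> x \<in> ?V"
      then show ?thesis by (auto simp: L_def key_order_def)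
    next
      assume *: "x \<in> part_A n \<and> y \<in> part_B n \<and> (x, y) \<in> E"
      then have "tilt_key n E a x \<le> tilt_key n E a y" if "a \<in> S" for a
      proof -
        have "x \<notin> part_B n" "y \<notin> part_A n" using * by (auto simp: part_A_def part_B_def)
        \<comment> \<open>Edges end in \<open>B\<close>, so \<open>x\<close> is never shifted; if
          \<open>x = a\<close>, then \<open>y\<close> is a neighbour of \<open>a\<close> and has
          been moved above it.\<close>
        then have "(a, x) \<notin> E" "y \<noteq> a" using assms(1) that S(2) by auto
        moreover have "x \<le> y" "x \<le> 2 * n" using * by (auto simp: part_A_def part_B_def)
        ultimately show ?thesis using * by (cases "x = a") (simp_all add: tilt_key_def)
      qed
      moreover have "rev x \<le> rev y" "id x \<le> id y"
        using * by (auto simp: rev_def part_A_def part_B_def)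
      ultimately show ?thesis using * by (auto simp: L_def key_order_def)
    qed
  qed
  ultimately have "realizer ?V (bip_order n E) L"
    by (simp add: realizer_def L_def)
  with fin card show ?thesis by blast
qed

lemma bip_dim_le:
  assumes "E \<subseteq> part_A n \<times> part_B n"
  shows "bip_dim n E \<le> card {a \<in> part_A n. \<exists>b\<in>part_B n. (a, b) \<notin> E} + 2"
  using bip_realizer[OF assms] poset_dim_le unfolding bip_dim_def by blast

text \<open>The data that lower bounds take from an optimal realizer. Here
  \<open>(b, a) \<in> l\<close> records that \<open>l\<close> reverses the non-edge
  \<open>(a, b)\<close>; the sets of reversed pairs are the chain graphs, and they cover all of
  \<open>H\<close>.\<close>

definition chain_cover :: "nat \<Rightarrow> (nat \<times> nat) set \<Rightarrow> nat rel set \<Rightarrow> bool" where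
  "chain_cover n E L \<longleftrightarrow> finite L \<and> card L = bip_dim n E \<and>
    (\<forall>l\<in>L. linear_order_on (part_A n \<union> part_B n) l) \<and>
    (\<forall>l\<in>L. \<forall>a\<in>part_A n. \<forall>b\<in>part_B n. (b, a) \<in> l \<longrightarrow> (a, b) \<notin> E) \<and>
    (\<forall>a\<in>part_A n. \<forall>b\<in>part_B n. (a, b) \<notin> E \<longrightarrow> (\<exists>l\<in>L. (b, a) \<in> l))"

text \<open>The non-edges reversed by a single linear extension form a chain graph, i.e. one without
  an induced matching of size two.\<close>
lemma bip_dim_chain_cover:
  assumes "E \<subseteq> part_A n \<times> part_B n"
  obtains L where "chain_cover n E L"
proof -
  let ?V = "part_A n \<union> part_B n"
  have disj: "part_A n \<inter> part_B n = {}" by (auto simp: part_A_def part_B_def)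
  obtain L where L: "realizer ?V (bip_order n E) L" "finite L" "card L = bip_dim n E"
  proof -
    obtain L0 where "realizer ?V (bip_order n E) L0" "finite L0"
      using bip_realizer[OF assms] by blast
    then show thesis
      by (rule poset_dim_attained) (simp add: that bip_dim_def)
  qed
  have lin: "linear_order_on ?V l" if "l \<in> L" for l
    using L(1) that by (simp add: realizer_def)
  have int: "\<Inter>L = bip_order n E" using L(1) by (simp add: realizer_def)
  have "(a, b) \<notin> E" if *: "l \<in> L" "a \<in> part_A n" "b \<in> part_B n" "(b, a) \<in> l" for l a b
  proof
    assume "(a, b) \<in> E"
    with * have "(a, b) \<in> \<Inter>L" unfolding int by (auto simp: bip_order_def)
    with * have "(a, b) \<in> l" by blast
    moreover have "antisym l" using lin[OF *(1)] by (simp add: order_on_defs)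
    ultimately have "a = b" using * by (auto simp: antisym_def)
    with * disj show False by blast
  qed
  moreover have "\<exists>l\<in>L. (b, a) \<in> l" if *: "a \<in> part_A n" "b \<in> part_B n" "(a, b) \<notin> E" for a b
  proof -
    have ab: "a \<noteq> b" using * disj by blast
    with * have "(a, b) \<notin> \<Inter>L" unfolding int by (auto simp: bip_order_def)
    then obtain l where l: "l \<in> L" "(a, b) \<notin> l" by blast
    moreover have "total_on ?V l" using lin[OF l(1)] by (simp add: order_on_defs)
    ultimately have "(b, a) \<in> l" using * ab by (auto simp: total_on_def)
    with l show ?thesis by blast
  qed
  ultimately have "chain_cover n E L"
    using L(2,3) lin by (simp add: chain_cover_def)
  then show thesis by (rule that)
qed

text \<open>In terms of \<open>H\<close>: the edge \<open>e\<close> is a connected component by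
  itself.\<close>

definition isolated_nonedge :: "nat \<Rightarrow> (nat \<times> nat) set \<Rightarrow> nat \<times> nat \<Rightarrow> bool" where
  "isolated_nonedge n E e \<longleftrightarrow>
     e \<notin> E \<and> ({fst e} \<times> part_B n \<union> part_A n \<times> {snd e}) - {e} \<subseteq> E"

text \<open>Two isolated edges of \<open>H\<close> form an induced matching, so no linear extension
  reverses both. Choosing for each isolated edge an order that reverses it is therefore an injection
  into the realizer.\<close>

lemma isolated_nonedges_le_bip_dim:
  assumes "E \<subseteq> part_A n \<times> part_B n"
  shows "card {e \<in> part_A n \<times> part_B n. isolated_nonedge n E e} \<le> bip_dim n E"
proof -
  let ?V = "part_A n \<union> part_B n"
  let ?I = "{e \<in> part_A n \<times> part_B n. isolated_nonedge n E e}"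
  obtain L where cov: "chain_cover n E L"
    by (rule bip_dim_chain_cover[OF assms])
  have L: "finite L" "card L = bip_dim n E"
    "\<And>l. l \<in> L \<Longrightarrow> linear_order_on ?V l"
    "\<And>l a b. l \<in> L \<Longrightarrow> a \<in> part_A n \<Longrightarrow> b \<in> part_B n \<Longrightarrow> (b, a) \<in> l \<Longrightarrow> (a, b) \<notin> E"
    "\<And>a b. a \<in> part_A n \<Longrightarrow> b \<in> part_B n \<Longrightarrow> (a, b) \<notin> E \<Longrightarrow> \<exists>l\<in>L. (b, a) \<in> l"
    using cov by (simp_all add: chain_cover_def)
  have "\<forall>e\<in>?I. \<exists>l\<in>L. (snd e, fst e) \<in> l"
  proof
    fix e assume "e \<in> ?I"
    then have "fst e \<in> part_A n" "snd e \<in> part_B n" "(fst e, snd e) \<notin> E"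
      by (simp_all add: isolated_nonedge_def mem_Times_iff)
    then show "\<exists>l\<in>L. (snd e, fst e) \<in> l" by (rule L(5))
  qed
  then have "\<forall>e\<in>?I. \<exists>l. l \<in> L \<and> (snd e, fst e) \<in> l" by blast
  from bchoice[OF this] obtain g where "\<forall>e\<in>?I. g e \<in> L \<and> (snd e, fst e) \<in> g e" ..
  then have g: "g e \<in> L \<and> (snd e, fst e) \<in> g e" if "e \<in> ?I" for e
    using that by (rule bspec)
  have iso: "(a', b') = (a, b)"
    if "isolated_nonedge n E (a, b)" "a' \<in> part_A n" "b' \<in> part_B n" "(a', b') \<notin> E" "a' = a \<or> b' = b"
    for a b a' b'
  proof -
    have "(a', b') \<in> {a} \<times> part_B n \<union> part_A n \<times> {b}" using that(2,3,5) by auto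
    then show ?thesis using that(1,4) unfolding isolated_nonedge_def fst_conv snd_conv by blast
  qed
  have "inj_on g ?I"
  proof (rule inj_onI, rule ccontr)
    fix e e' assume *: "e \<in> ?I" "e' \<in> ?I" "g e = g e'" "e \<noteq> e'"
    obtain a b where e1: "e = (a, b)" by (cases e)
    obtain a' b' where e2: "e' = (a', b')" by (cases e')
    note e = e1 e2
    have ge: "g e \<in> L" "(b, a) \<in> g e" "(b', a') \<in> g e"
      using g[OF *(1)] g[OF *(2)] *(3) e by simp_all
    have mem: "a \<in> part_A n" "b \<in> part_B n" "a' \<in> part_A n" "b' \<in> part_B n"
      using *(1,2) e by simp_all
    have isoe: "isolated_nonedge n E (a, b)" "isolated_nonedge n E (a', b')"
      using *(1,2) e by simp_all
    have lo: "trans (g e)" "total_on ?V (g e)" "refl_on ?V (g e)"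
      using L(3)[OF ge(1)] by (auto simp: order_on_defs)
    \<comment> \<open>The higher of \<open>a\<close> and \<open>a'\<close> lies above both
      \<open>b\<close> and \<open>b'\<close>, so one of the mixed pairs \<open>(a', b)\<close>,
      \<open>(a, b')\<close> is reversed and is a non-edge. It meets both isolated edges, hence
      equals both, against \<open>e \<noteq> e'\<close>.\<close>
    have "(a, a') \<in> g e \<or> (a', a) \<in> g e"
    proof (cases "a = a'")
      case True
      then show ?thesis using refl_onD[OF lo(3), of a] mem by simp
    next
      case False
      then show ?thesis using lo(2) mem unfolding total_on_def by blast
    qed
    then have "(b, a') \<in> g e \<or> (b', a) \<in> g e"
      using transD[OF lo(1) ge(2), of a'] transD[OF lo(1) ge(3), of a] by auto
    then have "(a', b) \<notin> E \<or> (a, b') \<notin> E"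
      using L(4)[OF ge(1) mem(3,2)] L(4)[OF ge(1) mem(1,4)] by auto
    then show False
    proof
      assume "(a', b) \<notin> E"
      then have "(a', b) = (a, b)" "(a', b) = (a', b')"
        using iso[OF isoe(1), of a' b] iso[OF isoe(2), of a' b] mem by simp_all
      with *(4) e show False by simp
    next
      assume "(a, b') \<notin> E"
      then have "(a, b') = (a, b)" "(a, b') = (a', b')"
        using iso[OF isoe(1), of a b'] iso[OF isoe(2), of a b'] mem by simp_all
      with *(4) e show False by simp
    qed
  qed
  moreover have "g ` ?I \<subseteq> L" using g by blast
  ultimately show ?thesis using card_inj_on_le[of g ?I L] L(1,2) by simp
qed

text \<open>A 4-cycle of \<open>H\<close> with its two vertices on each side in a chosen order. Each
  cycle is thus counted four times, and each of its vertices comes first in some quadruple.\<close>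

definition nonedge_C4 :: "(nat \<times> nat) set \<Rightarrow> nat \<Rightarrow> nat \<Rightarrow> nat \<Rightarrow> nat \<Rightarrow> bool" where
  "nonedge_C4 E a a' b b' \<longleftrightarrow> a \<noteq> a' \<and> b \<noteq> b' \<and> {a, a'} \<times> {b, b'} \<inter> E = {}"

text \<open>In a chain graph without 4-cycles, every edge meets the largest vertex of \<open>A'\<close> or the smallest
  vertex of \<open>B'\<close>; so \<open>d\<close> chain graphs leave only an empty rectangle after \<open>d\<close> rows and \<open>d\<close>
  columns are removed.\<close>
lemma bip_dim_empty_rectangle:
  assumes "E \<subseteq> part_A n \<times> part_B n"
  assumes A': "A' \<subseteq> part_A n" and B': "B' \<subseteq> part_B n"
  assumes C4: "\<And>a a' b b'. a \<in> A' \<Longrightarrow> a' \<in> A' \<Longrightarrow> b \<in> B' \<Longrightarrow> b' \<in> B' \<Longrightarrow> \<not> nonedge_C4 E a a' b b'"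
  obtains S T where "S \<subseteq> A'" "T \<subseteq> B'" "S \<times> T \<subseteq> E"
    "card A' \<le> card S + bip_dim n E" "card B' \<le> card T + bip_dim n E"
proof -
  let ?V = "part_A n \<union> part_B n"
  obtain L where cov: "chain_cover n E L"
    by (rule bip_dim_chain_cover[OF assms(1)])
  have L: "finite L" "card L = bip_dim n E"
    "\<And>l. l \<in> L \<Longrightarrow> linear_order_on ?V l"
    "\<And>l a b. l \<in> L \<Longrightarrow> a \<in> part_A n \<Longrightarrow> b \<in> part_B n \<Longrightarrow> (b, a) \<in> l \<Longrightarrow> (a, b) \<notin> E"
    "\<And>a b. a \<in> part_A n \<Longrightarrow> b \<in> part_B n \<Longrightarrow> (a, b) \<notin> E \<Longrightarrow> \<exists>l\<in>L. (b, a) \<in> l"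
    using cov by (simp_all add: chain_cover_def)
  have fin: "finite A'" "finite B'" using A' B' finite_subset finite_part by blast+
  \<comment> \<open>The guard covers an empty \<open>A'\<close>, where \<open>top l\<close> is
    arbitrary; \<open>top\<close> is evaluated below only when some \<open>a \<in> A'\<close> is at
    hand. The same applies to \<open>bot\<close>.\<close>
  have "\<forall>l\<in>L. \<exists>m. A' \<noteq> {} \<longrightarrow> m \<in> A' \<and> (\<forall>a\<in>A'. (a, m) \<in> l)"
  proof
    fix l assume "l \<in> L"
    then show "\<exists>m. A' \<noteq> {} \<longrightarrow> m \<in> A' \<and> (\<forall>a\<in>A'. (a, m) \<in> l)"
      using linear_order_on_finite_max[OF L(3)[of l] fin(1)] A' by auto
  qed
  from bchoice[OF this] obtain top
    where top: "\<And>l a. l \<in> L \<Longrightarrow> a \<in> A' \<Longrightarrow> top l \<in> A' \<and> (a, top l) \<in> l"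
    by blast
  have "\<forall>l\<in>L. \<exists>m. B' \<noteq> {} \<longrightarrow> m \<in> B' \<and> (\<forall>b\<in>B'. (m, b) \<in> l)"
  proof
    fix l assume "l \<in> L"
    then show "\<exists>m. B' \<noteq> {} \<longrightarrow> m \<in> B' \<and> (\<forall>b\<in>B'. (m, b) \<in> l)"
      using linear_order_on_finite_min[OF L(3)[of l] fin(2)] B' by auto
  qed
  from bchoice[OF this] obtain bot
    where bot: "\<And>l b. l \<in> L \<Longrightarrow> b \<in> B' \<Longrightarrow> bot l \<in> B' \<and> (bot l, b) \<in> l"
    by blast
  define S where "S = A' - top ` L"
  define T where "T = B' - bot ` L"
  have card: "card X \<le> card (X - f ` L) + bip_dim n E" if "finite X" for X :: "nat set" and f
  proof -
    have "card X \<le> card ((X - f ` L) \<union> f ` L)"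
      using that L(1) by (intro card_mono) auto
    also have "\<dots> \<le> card (X - f ` L) + card (f ` L)" by (rule card_Un_le)
    also have "\<dots> \<le> card (X - f ` L) + card L" using card_image_le[OF L(1), of f] by simp
    finally show ?thesis using L(2) by simp
  qed
  have "S \<times> T \<subseteq> E"
  proof (rule subrelI, rule ccontr)
    fix a b assume "(a, b) \<in> S \<times> T" and nE: "(a, b) \<notin> E"
    then have ab: "a \<in> A'" "b \<in> B'" "a \<notin> top ` L" "b \<notin> bot ` L" by (auto simp: S_def T_def)
    with nE obtain l where l: "l \<in> L" "(b, a) \<in> l"
      using L(5)[OF subsetD[OF A' ab(1)] subsetD[OF B' ab(2)] nE] by blast
    have tr: "trans l" using L(3)[OF l(1)] by (simp add: order_on_defs)
    \<comment> \<open>In \<open>l\<close> the order is \<open>b'\<close>, \<open>b\<close>,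
      \<open>a\<close>, \<open>a'\<close> from bottom to top, so all four pairs are reversed. As
      \<open>a\<close> and \<open>b\<close> survived the deletion, they differ from
      \<open>a'\<close> and \<open>b'\<close>, and a 4-cycle of \<open>H\<close> appears.\<close>
    define a' where "a' = top l"
    define b' where "b' = bot l"
    have a': "a' \<in> A'" "(a, a') \<in> l" "a \<noteq> a'" and b': "b' \<in> B'" "(b', b) \<in> l" "b \<noteq> b'"
      using top[OF l(1) ab(1)] bot[OF l(1) ab(2)] ab l(1) by (auto simp: a'_def b'_def)
    have "(b, a') \<in> l" using transD[OF tr l(2) a'(2)] .
    moreover have "(b', a) \<in> l" using transD[OF tr b'(2) l(2)] .
    moreover from this have "(b', a') \<in> l" using transD[OF tr _ a'(2)] by simp
    moreover have "a \<in> part_A n" "a' \<in> part_A n" "b \<in> part_B n" "b' \<in> part_B n"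
      using ab(1,2) a'(1) b'(1) A' B' by auto
    ultimately have "(a, b) \<notin> E" "(a', b) \<notin> E" "(a, b') \<notin> E" "(a', b') \<notin> E"
      using l(2) L(4)[OF l(1)] by simp_all
    then have "nonedge_C4 E a a' b b'"
      using a'(3) b'(3) by (simp add: nonedge_C4_def)
    with C4[OF ab(1) a'(1) ab(2) b'(1)] show False by simp
  qed
  then show thesis
    using that[of S T] card[OF fin(1), of top] card[OF fin(2), of bot] by (auto simp: S_def T_def)
qed

text \<open>Every vertex on a 4-cycle of non-edges is the first vertex of its part in some quadruple, so
  deleting all of them costs at most as many vertices per side as there are quadruples.\<close>
lemma bip_dim_large_empty_rectangle:
  assumes "E \<subseteq> part_A n \<times> part_B n"
  defines "Z \<equiv> card {(a, a', b, b') \<in> part_A n \<times> part_A n \<times> part_B n \<times> part_B n. nonedge_C4 E a a' b b'}"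
  obtains S T where "S \<subseteq> part_A n" "T \<subseteq> part_B n" "S \<times> T \<subseteq> E"
    "n \<le> card S + bip_dim n E + Z" "n \<le> card T + bip_dim n E + Z"
proof -
  define Q where "Q = {(a, a', b, b') \<in> part_A n \<times> part_A n \<times> part_B n \<times> part_B n. nonedge_C4 E a a' b b'}"
  have "finite Q"
    by (rule finite_subset[of _ "part_A n \<times> part_A n \<times> part_B n \<times> part_B n"]) (auto simp: Q_def)
  define A' where "A' = part_A n - (\<lambda>(a, a', b, b'). a) ` Q"
  define B' where "B' = part_B n - (\<lambda>(a, a', b, b'). b) ` Q"
  have card: "card X \<le> card (X - f ` Q) + Z" if "finite X" for X :: "nat set" and f
  proof -
    have "card X \<le> card ((X - f ` Q) \<union> f ` Q)"
      using that \<open>finite Q\<close> by (intro card_mono) auto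
    also have "\<dots> \<le> card (X - f ` Q) + card (f ` Q)" by (rule card_Un_le)
    also have "\<dots> \<le> card (X - f ` Q) + card Q" using card_image_le[OF \<open>finite Q\<close>, of f] by simp
    finally show ?thesis by (simp add: Z_def Q_def)
  qed
  have cards: "n \<le> card A' + Z" "n \<le> card B' + Z"
    unfolding A'_def B'_def using card[OF finite_part(1)[of n]] card[OF finite_part(2)[of n]] by auto
  have C4: "\<not> nonedge_C4 E a a' b b'" if "a \<in> A'" "a' \<in> A'" "b \<in> B'" "b' \<in> B'" for a a' b b'
  proof
    assume "nonedge_C4 E a a' b b'"
    with that have "(a, a', b, b') \<in> Q" by (auto simp: Q_def A'_def B'_def)
    then have "a \<in> (\<lambda>(a, a', b, b'). a) ` Q" by force
    with that show False by (simp add: A'_def)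
  qed
  have sub: "A' \<subseteq> part_A n" "B' \<subseteq> part_B n" by (auto simp: A'_def B'_def)
  show thesis
  proof (rule bip_dim_empty_rectangle[OF assms(1) sub C4])
    fix S T assume "S \<subseteq> A'" "T \<subseteq> B'" "S \<times> T \<subseteq> E"
      "card A' \<le> card S + bip_dim n E" "card B' \<le> card T + bip_dim n E"
    with cards sub show thesis
      by (intro that[of S T]) auto
  qed
qed

subsection \<open>Probability estimates\<close>

text \<open>Asking for the implication on the support alone gives access to
  \<open>E \<subseteq> part_A n \<times> part_B n\<close> for random graphs.\<close>

lemma aas_mono:
  assumes "aas M Q" "\<forall>\<^sub>F n in sequentially. \<forall>x\<in>set_pmf (M n). Q n x \<longrightarrow> R n x"
  shows "aas M R"
  unfolding aas_def
proof (rule tendsto_sandwich[OF _ _ assms(1)[unfolded aas_def] tendsto_const])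
  show "\<forall>\<^sub>F n in sequentially. measure_pmf.prob (M n) {x. Q n x} \<le> measure_pmf.prob (M n) {x. R n x}"
    using assms(2)
  proof eventually_elim
    case (elim n)
    have "measure_pmf.prob (M n) {x. Q n x} = measure_pmf.prob (M n) ({x. Q n x} \<inter> set_pmf (M n))"
      by (simp add: measure_Int_set_pmf)
    also have "\<dots> \<le> measure_pmf.prob (M n) {x. R n x}"
      using elim by (intro measure_pmf.finite_measure_mono) auto
    finally show ?case .
  qed
qed simp_all

lemma aasI:
  assumes "\<forall>\<^sub>F n in sequentially. measure_pmf.prob (M n) {x. \<not> Q n x} \<le> b n" "b \<longlonglongrightarrow> 0"
  shows "aas M Q"
  unfolding aas_def
proof (rule tendsto_sandwich)
  have *: "measure_pmf.prob (M n) {x. Q n x} = 1 - measure_pmf.prob (M n) {x. \<not> Q n x}" for n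
    using measure_pmf.prob_compl[of "{x. \<not> Q n x}" "M n"] by (simp add: Compl_eq_Diff_UNIV[symmetric] Collect_neg_eq)
  show "\<forall>\<^sub>F n in sequentially. 1 - b n \<le> measure_pmf.prob (M n) {x. Q n x}"
    using assms(1) by eventually_elim (simp add: *)
  show "(\<lambda>n. 1 - b n) \<longlonglongrightarrow> 1"
    using tendsto_diff[OF tendsto_const assms(2), of 1] by simp
qed auto

lemma aas_conj:
  assumes "aas M Q" "aas M R"
  shows "aas M (\<lambda>n x. Q n x \<and> R n x)"
proof (rule aasI)
  let ?P = "\<lambda>n S. measure_pmf.prob (M n) S"
  let ?b = "\<lambda>n. (1 - ?P n {x. Q n x}) + (1 - ?P n {x. R n x})"
  have compl: "?P n {x. \<not> S x} = 1 - ?P n {x. S x}" for n S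
    using measure_pmf.prob_compl[of "{x. S x}" "M n"] by (simp add: Compl_eq_Diff_UNIV[symmetric] Collect_neg_eq)
  have "?P n {x. \<not> (Q n x \<and> R n x)} \<le> ?b n" for n
  proof -
    have "{x. \<not> (Q n x \<and> R n x)} = {x. \<not> Q n x} \<union> {x. \<not> R n x}" by auto
    then have "?P n {x. \<not> (Q n x \<and> R n x)} \<le> ?P n {x. \<not> Q n x} + ?P n {x. \<not> R n x}"
      using measure_Un_le[of "{x. \<not> Q n x}" "measure_pmf (M n)" "{x. \<not> R n x}"] by simp
    then show ?thesis by (simp only: compl)
  qed
  then show "\<forall>\<^sub>F n in sequentially. ?P n {x. \<not> (Q n x \<and> R n x)} \<le> ?b n" by simp
  have "?b \<longlonglongrightarrow> (1 - 1) + (1 - 1)"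
    using assms unfolding aas_def by (intro tendsto_intros)
  then show "?b \<longlonglongrightarrow> 0" by simp
qed

section \<open>First and second moment bounds for counting variables\<close>

lemma integrable_pmf_indicator [simp]: "integrable (measure_pmf M) (indicator S :: 'a \<Rightarrow> real)"
  by (rule integrable_real_indicator) (simp_all add: measure_pmf.emeasure_eq_measure)

lemma pmf_count_markov:
  fixes M :: "'a pmf"
  assumes "finite I" "\<And>i. i \<in> I \<Longrightarrow> measure_pmf.prob M {x. P i x} \<le> \<mu>" "t > 0"
  shows "measure_pmf.prob M {x. t \<le> real (card {i \<in> I. P i x})} \<le> real (card I) * \<mu> / t"
proof -
  let ?X = "\<lambda>x. real (card {i \<in> I. P i x})"
  have X: "?X x = (\<Sum>i\<in>I. indicator {x. P i x} x)" for x
    using assms(1) by (simp add: indicator_def sum.If_cases Int_def)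
  have "measure_pmf.expectation M ?X = (\<Sum>i\<in>I. measure_pmf.prob M {x. P i x})"
    unfolding X by (subst Bochner_Integration.integral_sum) auto
  also have "\<dots> \<le> real (card I) * \<mu>"
    using sum_bounded_above[of I "\<lambda>i. measure_pmf.prob M {x. P i x}" \<mu>] assms(2) by simp
  finally have E: "measure_pmf.expectation M ?X \<le> real (card I) * \<mu>" .
  have int: "integrable (measure_pmf M) ?X"
    unfolding X by (intro Bochner_Integration.integrable_sum) auto
  have "measure_pmf.prob M {x \<in> space M. t \<le> ?X x} \<le> measure_pmf.expectation M ?X / t"
    by (rule integral_Markov_inequality_measure[OF int, of "{}"]) (use assms(3) in auto)
  also have "\<dots> \<le> real (card I) * \<mu> / t" using E assms(3) by (simp add: divide_right_mono)
  finally show ?thesis by simp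
qed

text \<open>Second moment method. If pairs are correlated by a factor of at most
  \<open>1 + \<rho>\<close>, the variance is at most \<open>m + \<rho> * m\<^sup>2\<close>, and
  Chebyshev with deviation \<open>m / 2\<close> gives the bound.\<close>

lemma pmf_count_chebyshev:
  fixes M :: "'a pmf"
  assumes "finite I" and \<mu>: "\<And>i. i \<in> I \<Longrightarrow> measure_pmf.prob M {x. P i x} = \<mu>"
    and pair: "\<And>i j. i \<in> I \<Longrightarrow> j \<in> I \<Longrightarrow> i \<noteq> j \<Longrightarrow>
      measure_pmf.prob M {x. P i x \<and> P j x} \<le> \<mu>\<^sup>2 * (1 + \<rho>)"
    and "\<rho> \<ge> 0"
  defines "m \<equiv> real (card I) * \<mu>"
  assumes "m > 0"
  shows "measure_pmf.prob M {x. \<not> (m / 2 \<le> real (card {i \<in> I. P i x}) \<and> real (card {i \<in> I. P i x}) \<le> 3 / 2 * m)}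
          \<le> 4 / m + 4 * \<rho>"
proof -
  let ?X = "\<lambda>x. real (card {i \<in> I. P i x})"
  have X: "?X x = (\<Sum>i\<in>I. indicator {x. P i x} x)" for x
    using assms(1) by (simp add: indicator_def sum.If_cases Int_def)
  have X2: "(?X x)\<^sup>2 = (\<Sum>i\<in>I. \<Sum>j\<in>I. indicator {x. P i x \<and> P j x} x)" for x
    unfolding X power2_eq_square sum_product
    by (intro sum.cong refl) (auto simp: indicator_def)
  have EX: "measure_pmf.expectation M ?X = m"
    unfolding X m_def by (subst Bochner_Integration.integral_sum) (auto simp: \<mu>)
  have int2: "integrable (measure_pmf M) (\<lambda>x. (?X x)\<^sup>2)"
    unfolding X2 by (intro Bochner_Integration.integrable_sum) auto
  have int: "integrable (measure_pmf M) ?X"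
    unfolding X by (intro Bochner_Integration.integrable_sum) auto
  have "measure_pmf.expectation M (\<lambda>x. (?X x)\<^sup>2) = (\<Sum>i\<in>I. \<Sum>j\<in>I. measure_pmf.prob M {x. P i x \<and> P j x})"
    unfolding X2 by (subst Bochner_Integration.integral_sum) (auto simp: Bochner_Integration.integral_sum)
  \<comment> \<open>The diagonal is not covered by \<open>pair\<close>; its terms equal
    \<open>\<mu>\<close> and are paid for by the extra summand.\<close>
  also have "\<dots> \<le> (\<Sum>i\<in>I. \<Sum>j\<in>I. \<mu>\<^sup>2 * (1 + \<rho>) + (if j = i then \<mu> else 0))"
  proof (intro sum_mono)
    fix i j assume ij: "i \<in> I" "j \<in> I"
    show "measure_pmf.prob M {x. P i x \<and> P j x} \<le> \<mu>\<^sup>2 * (1 + \<rho>) + (if j = i then \<mu> else 0)"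
      using pair[OF ij] \<mu>[OF ij(1)] \<open>\<rho> \<ge> 0\<close> by auto
  qed
  also have "\<dots> = m\<^sup>2 * (1 + \<rho>) + m"
    using \<open>finite I\<close> by (simp add: sum.distrib m_def power2_eq_square algebra_simps)
  finally have E2: "measure_pmf.expectation M (\<lambda>x. (?X x)\<^sup>2) \<le> m\<^sup>2 * (1 + \<rho>) + m" .
  have "measure_pmf.variance M ?X = measure_pmf.expectation M (\<lambda>x. (?X x)\<^sup>2) - m\<^sup>2"
    using measure_pmf.variance_eq[OF int int2] EX by simp
  with E2 have var: "measure_pmf.variance M ?X \<le> m\<^sup>2 * \<rho> + m" by (simp add: algebra_simps)
  have "measure_pmf.prob M {x. \<not> (m / 2 \<le> ?X x \<and> ?X x \<le> 3 / 2 * m)}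
      \<le> measure_pmf.prob M {x \<in> space M. \<bar>?X x - measure_pmf.expectation M ?X\<bar> \<ge> m / 2}"
    unfolding EX by (intro measure_pmf.finite_measure_mono) (auto simp: abs_if field_simps)
  also have "\<dots> \<le> measure_pmf.variance M ?X / (m / 2)\<^sup>2"
    by (rule measure_pmf.Chebyshev_inequality[OF _ int2]) (use \<open>m > 0\<close> in auto)
  also have "\<dots> \<le> (m\<^sup>2 * \<rho> + m) / (m / 2)\<^sup>2"
    by (intro divide_right_mono var) simp
  also have "\<dots> = 4 / m + 4 * \<rho>"
    using \<open>m > 0\<close> by (simp add: field_simps power2_eq_square)
  finally show ?thesis .
qed

text \<open>Both error terms of \<open>pmf_count_chebyshev\<close> vanish once the mean diverges and
  the correlation defect \<open>\<rho>\<close> tends to 0.\<close>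

lemma aas_count_concentrated:
  fixes M :: "nat \<Rightarrow> 'a pmf"
  assumes "\<And>n. finite (I n)"
    and "\<forall>\<^sub>F n in sequentially. \<forall>i\<in>I n. measure_pmf.prob (M n) {x. P n i x} = \<mu> n"
    and "\<forall>\<^sub>F n in sequentially. \<forall>i\<in>I n. \<forall>j\<in>I n. i \<noteq> j \<longrightarrow>
      measure_pmf.prob (M n) {x. P n i x \<and> P n j x} \<le> (\<mu> n)\<^sup>2 * (1 + \<rho> n)"
    and "\<forall>\<^sub>F n in sequentially. \<rho> n \<ge> 0" and \<rho>: "\<rho> \<longlonglongrightarrow> 0"
    and m: "filterlim (\<lambda>n. real (card (I n)) * \<mu> n) at_top sequentially"
  shows "aas M (\<lambda>n x. real (card (I n)) * \<mu> n / 2 \<le> real (card {i \<in> I n. P n i x}) \<and>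
    real (card {i \<in> I n. P n i x}) \<le> 3 / 2 * (real (card (I n)) * \<mu> n))"
proof (rule aasI)
  let ?m = "\<lambda>n. real (card (I n)) * \<mu> n"
  have pos: "\<forall>\<^sub>F n in sequentially. ?m n > 0" using m by (simp add: filterlim_at_top_dense)
  show "\<forall>\<^sub>F n in sequentially. measure_pmf.prob (M n)
      {x. \<not> (?m n / 2 \<le> real (card {i \<in> I n. P n i x}) \<and> real (card {i \<in> I n. P n i x}) \<le> 3 / 2 * ?m n)}
    \<le> 4 / ?m n + 4 * \<rho> n"
    using pos assms(2-4)
  proof eventually_elim
    case (elim n)
    then show ?case
      using assms(1)[of n]
      by (intro pmf_count_chebyshev[where I = "I n" and \<mu> = "\<mu> n" and P = "P n" and \<rho> = "\<rho> n"]) auto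
  qed
  have "(\<lambda>n. 4 / ?m n + 4 * \<rho> n) \<longlonglongrightarrow> 0 + 4 * 0"
    by (intro tendsto_intros \<rho> real_tendsto_divide_at_top[OF tendsto_const m])
  then show "(\<lambda>n. 4 / ?m n + 4 * \<rho> n) \<longlonglongrightarrow> 0" by simp
qed

subsection \<open>The random bipartite graph\<close>

lemma random_bipartite_subset:
  "E \<in> set_pmf (random_bipartite n p) \<Longrightarrow> E \<subseteq> part_A n \<times> part_B n"
  by (auto simp: random_bipartite_def)

text \<open>The event is a box in the product space: coordinates in \<open>U\<close> and
  \<open>W\<close> are forced, all others are free, and independence gives the product.\<close>

lemma prob_random_bipartite:
  assumes p: "0 \<le> p" "p \<le> 1"
    and UW: "U \<subseteq> part_A n \<times> part_B n" "W \<subseteq> part_A n \<times> part_B n" "U \<inter> W = {}"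
  shows "measure_pmf.prob (random_bipartite n p) {E. U \<subseteq> E \<and> W \<inter> E = {}} = p ^ card U * (1 - p) ^ card W"
proof -
  let ?C = "part_A n \<times> part_B n"
  define B where "B e = (if e \<in> U then {True} else if e \<in> W then {False} else UNIV)" for e
  have fin: "finite ?C" by simp
  have "(\<lambda>f. {e \<in> ?C. f e}) -` {E. U \<subseteq> E \<and> W \<inter> E = {}} = Pi ?C B"
  proof (intro equalityI subsetI)
    fix f assume "f \<in> (\<lambda>f. {e \<in> ?C. f e}) -` {E. U \<subseteq> E \<and> W \<inter> E = {}}"
    then show "f \<in> Pi ?C B" by (intro Pi_I) (auto simp: B_def)
  next
    fix f assume f: "f \<in> Pi ?C B"
    have "f e" if "e \<in> U" for e using Pi_mem[OF f, of e] that UW by (auto simp: B_def)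
    moreover have "\<not> f e" if "e \<in> W" for e
    proof -
      have "e \<in> ?C" "e \<notin> U" using that UW by blast+
      with Pi_mem[OF f, of e] that show ?thesis by (simp add: B_def)
    qed
    ultimately show "f \<in> (\<lambda>f. {e \<in> ?C. f e}) -` {E. U \<subseteq> E \<and> W \<inter> E = {}}"
      using UW by auto
  qed
  then have "measure_pmf.prob (random_bipartite n p) {E. U \<subseteq> E \<and> W \<inter> E = {}}
      = (\<Prod>e\<in>?C. measure_pmf.prob (bernoulli_pmf p) (B e))"
    by (simp add: random_bipartite_def measure_map_pmf measure_Pi_pmf_Pi)
  also have "\<dots> = (\<Prod>e\<in>?C. (if e \<in> U then p else 1) * (if e \<in> W then 1 - p else 1))"
    using p UW(3) by (intro prod.cong refl) (auto simp: B_def measure_pmf_single)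
  also have "\<dots> = p ^ card U * (1 - p) ^ card W"
    using UW by (simp add: prod.distrib prod.If_cases Int_absorb1)
  finally show ?thesis .
qed

lemma prob_nonedges:
  assumes "0 \<le> p" "p \<le> 1" "W \<subseteq> part_A n \<times> part_B n"
  shows "measure_pmf.prob (random_bipartite n p) {E. W \<inter> E = {}} = (1 - p) ^ card W"
  using prob_random_bipartite[of p "{}" n W] assms by simp

lemma prob_edges:
  assumes "0 \<le> p" "p \<le> 1" "U \<subseteq> part_A n \<times> part_B n"
  shows "measure_pmf.prob (random_bipartite n p) {E. U \<subseteq> E} = p ^ card U"
  using prob_random_bipartite[of p U n "{}"] assms by simp

text \<open>For a cell \<open>e\<close> of the grid, its neighbours in the line graph of the
  complete bipartite graph.\<close>

definition cross :: "nat \<Rightarrow> nat \<times> nat \<Rightarrow> (nat \<times> nat) set" where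
  "cross n e = {fst e} \<times> part_B n \<union> part_A n \<times> {snd e} - {e}"

lemma card_cross:
  assumes "e \<in> part_A n \<times> part_B n"
  shows "card (cross n e) = 2 * (n - 1)"
proof -
  obtain a b where e: "e = (a, b)" "a \<in> part_A n" "b \<in> part_B n" using assms by auto
  have "cross n e = {a} \<times> (part_B n - {b}) \<union> (part_A n - {a}) \<times> {b}"
    using e by (auto simp: cross_def)
  also have "card \<dots> = card ({a} \<times> (part_B n - {b})) + card ((part_A n - {a}) \<times> {b})"
    by (intro card_Un_disjoint) auto
  also have "\<dots> = 2 * (n - 1)" using e by (simp add: card_cartesian_product)
  finally show ?thesis .
qed

lemma isolated_nonedge_cross:
  "isolated_nonedge n E e \<longleftrightarrow> cross n e \<subseteq> E \<and> {e} \<inter> E = {}"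
  unfolding isolated_nonedge_def cross_def by blast

lemma cross_subset: "e \<in> part_A n \<times> part_B n \<Longrightarrow> cross n e \<subseteq> part_A n \<times> part_B n"
  by (auto simp: cross_def)

lemma prob_isolated_nonedge:
  assumes "0 \<le> p" "p \<le> 1" "e \<in> part_A n \<times> part_B n"
  shows "measure_pmf.prob (random_bipartite n p) {E. isolated_nonedge n E e} = p ^ (2 * (n - 1)) * (1 - p)"
proof -
  have "cross n e \<inter> {e} = {}" by (simp add: cross_def)
  then show ?thesis
    unfolding isolated_nonedge_cross
    using prob_random_bipartite[OF assms(1,2) cross_subset[OF assms(3)], of "{e}"] assms(3)
    by (simp add: card_cross)
qed

text \<open>Pairs sharing a vertex cannot both be isolated. Otherwise the two crosses overlap in at
  most the two corners \<open>(a, b')\<close> and \<open>(a', b)\<close>, and the factor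
  \<open>1 / p\<^sup>2\<close> pays for these.\<close>

lemma prob_isolated_nonedge_pair:
  assumes p: "0 < p" "p \<le> 1" and e: "e \<in> part_A n \<times> part_B n" "e' \<in> part_A n \<times> part_B n" "e \<noteq> e'"
  shows "measure_pmf.prob (random_bipartite n p) {E. isolated_nonedge n E e \<and> isolated_nonedge n E e'}
    \<le> (p ^ (2 * (n - 1)) * (1 - p))\<^sup>2 * (1 / p\<^sup>2)"
proof (cases "e \<in> cross n e' \<or> e' \<in> cross n e")
  case True
  then have "{E. isolated_nonedge n E e \<and> isolated_nonedge n E e'} = {}"
    unfolding isolated_nonedge_cross by blast
  then show ?thesis by (simp only: measure_empty) simp
next
  case False
  obtain a b a' b' where ab: "e = (a, b)" "e' = (a', b')"
    by (metis surj_pair)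
  let ?U = "cross n e \<union> cross n e'" and ?W = "{e, e'}"
  have eq: "{E. isolated_nonedge n E e \<and> isolated_nonedge n E e'} = {E. ?U \<subseteq> E \<and> ?W \<inter> E = {}}"
    unfolding isolated_nonedge_cross by blast
  have "e \<notin> cross n e" "e' \<notin> cross n e'" by (simp_all add: cross_def)
  then have disj: "?U \<inter> ?W = {}" using False by blast
  have fin: "finite (cross n e)" "finite (cross n e')" by (auto simp: cross_def)
  have "cross n e \<inter> cross n e' \<subseteq> {(a, b'), (a', b)}"
    using False e ab by (auto simp: cross_def)
  then have "card (cross n e \<inter> cross n e') \<le> card {(a, b'), (a', b)}" by (intro card_mono) auto
  also have "\<dots> \<le> 2" by (simp add: card_insert_if)
  \<comment> \<open>The overlap is kept on the left, which avoids truncated subtraction in the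
    exponent.\<close>
  finally have "card ?U + 2 \<ge> 4 * (n - 1)"
    using card_Un_Int[OF fin] card_cross[OF e(1)] card_cross[OF e(2)] by simp
  then have "p ^ (card ?U + 2) \<le> p ^ (4 * (n - 1))"
    using p by (intro power_decreasing) auto
  then have U: "p ^ card ?U \<le> p ^ (4 * (n - 1)) / p\<^sup>2"
    using p by (simp add: field_simps power_add power2_eq_square)
  have "measure_pmf.prob (random_bipartite n p) {E. ?U \<subseteq> E \<and> ?W \<inter> E = {}} = p ^ card ?U * (1 - p) ^ card ?W"
    using p e cross_subset[OF e(1)] cross_subset[OF e(2)] disj by (intro prob_random_bipartite) auto
  also have "\<dots> \<le> (p ^ (4 * (n - 1)) / p\<^sup>2) * (1 - p) ^ card ?W"
    using p by (intro mult_right_mono U) auto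
  also have "\<dots> = (p ^ (2 * (n - 1)) * (1 - p))\<^sup>2 * (1 / p\<^sup>2)"
  proof -
    have "p ^ (4 * (n - 1)) = (p ^ (2 * (n - 1)))\<^sup>2" by (simp flip: power_mult)
    moreover have "card ?W = 2" using e(3) by simp
    ultimately show ?thesis by (simp add: power_mult_distrib)
  qed
  finally show ?thesis unfolding eq .
qed

section \<open>Concentration of non-edges, full rows and isolated non-edges\<close>

lemma aas_nonedges_concentrated:
  assumes p: "\<And>n. 0 \<le> p n" "\<And>n. p n \<le> 1"
    and m: "filterlim (\<lambda>n. (real n)\<^sup>2 * (1 - p n)) at_top sequentially"
  shows "aas (\<lambda>n. random_bipartite n (p n))
    (\<lambda>n E. real (card {e \<in> part_A n \<times> part_B n. e \<notin> E}) \<le> 3 / 2 * ((real n)\<^sup>2 * (1 - p n)))"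
proof -
  let ?M = "\<lambda>n. random_bipartite n (p n)"
  have m': "real (card (part_A n \<times> part_B n)) * (1 - p n) = (real n)\<^sup>2 * (1 - p n)" for n
    by (simp add: card_cartesian_product power2_eq_square)
  have 1: "measure_pmf.prob (?M n) {E. e \<notin> E} = 1 - p n" if "e \<in> part_A n \<times> part_B n" for n e
    using prob_nonedges[of "p n" "{e}" n] p that by simp
  have 2: "measure_pmf.prob (?M n) {E. e \<notin> E \<and> e' \<notin> E} = (1 - p n)\<^sup>2"
    if "e \<in> part_A n \<times> part_B n" "e' \<in> part_A n \<times> part_B n" "e \<noteq> e'" for n e e'
    using prob_nonedges[of "p n" "{e, e'}" n] p that by (simp add: numeral_2_eq_2)
  have "aas ?M (\<lambda>n E. real (card (part_A n \<times> part_B n)) * (1 - p n) / 2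
      \<le> real (card {e \<in> part_A n \<times> part_B n. e \<notin> E}) \<and>
    real (card {e \<in> part_A n \<times> part_B n. e \<notin> E}) \<le> 3 / 2 * (real (card (part_A n \<times> part_B n)) * (1 - p n)))"
  proof (rule aas_count_concentrated[where \<rho> = "\<lambda>_. 0"])
    show "filterlim (\<lambda>n. real (card (part_A n \<times> part_B n)) * (1 - p n)) at_top sequentially"
      using m by (simp only: m')
    show "\<forall>\<^sub>F n in sequentially. \<forall>e\<in>part_A n \<times> part_B n.
        measure_pmf.prob (?M n) {E. e \<notin> E} = 1 - p n"
      by (intro always_eventually allI ballI 1)
    show "\<forall>\<^sub>F n in sequentially. \<forall>e\<in>part_A n \<times> part_B n. \<forall>e'\<in>part_A n \<times> part_B n. e \<noteq> e' \<longrightarrow>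
        measure_pmf.prob (?M n) {E. e \<notin> E \<and> e' \<notin> E} \<le> (1 - p n)\<^sup>2 * (1 + 0)"
      by (intro always_eventually allI ballI impI) (rule order.trans[OF eq_refl[OF 2]], assumption+, simp)
  qed simp_all
  then show ?thesis by (rule aas_mono) (simp only: m', simp)
qed

text \<open>Full rows are the isolated vertices of \<open>H\<close> in \<open>A\<close>. Distinct
  rows are disjoint, hence independent, so the correlation defect is 0.\<close>

lemma aas_full_rows_concentrated:
  assumes p: "\<And>n. 0 \<le> p n" "\<And>n. p n \<le> 1"
    and m: "filterlim (\<lambda>n. real n * p n ^ n) at_top sequentially"
  shows "aas (\<lambda>n. random_bipartite n (p n))
    (\<lambda>n E. real n * p n ^ n / 2 \<le> real (card {a \<in> part_A n. {a} \<times> part_B n \<subseteq> E}))"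
proof -
  let ?M = "\<lambda>n. random_bipartite n (p n)"
  have 1: "measure_pmf.prob (?M n) {E. {a} \<times> part_B n \<subseteq> E} = p n ^ n" if "a \<in> part_A n" for n a
    using prob_edges[of "p n" "{a} \<times> part_B n" n] p that by (auto simp: card_cartesian_product)
  have 2: "measure_pmf.prob (?M n) {E. {a} \<times> part_B n \<subseteq> E \<and> {a'} \<times> part_B n \<subseteq> E} = (p n ^ n)\<^sup>2"
    if "a \<in> part_A n" "a' \<in> part_A n" "a \<noteq> a'" for n a a'
  proof -
    have "{E. {a} \<times> part_B n \<subseteq> E \<and> {a'} \<times> part_B n \<subseteq> E} = {E. {a, a'} \<times> part_B n \<subseteq> E}" by auto
    moreover have "{a, a'} \<times> part_B n \<subseteq> part_A n \<times> part_B n" using that by auto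
    ultimately show ?thesis
      using prob_edges[of "p n" "{a, a'} \<times> part_B n" n] p that
      by (simp add: card_cartesian_product power_mult[symmetric] mult.commute mult_2_right)
  qed
  have "aas ?M (\<lambda>n E. real (card (part_A n)) * p n ^ n / 2
      \<le> real (card {a \<in> part_A n. {a} \<times> part_B n \<subseteq> E}) \<and>
    real (card {a \<in> part_A n. {a} \<times> part_B n \<subseteq> E}) \<le> 3 / 2 * (real (card (part_A n)) * p n ^ n))"
  proof (rule aas_count_concentrated[where \<rho> = "\<lambda>_. 0"])
    show "filterlim (\<lambda>n. real (card (part_A n)) * p n ^ n) at_top sequentially"
      using m by simp
    show "\<forall>\<^sub>F n in sequentially. \<forall>a\<in>part_A n.
        measure_pmf.prob (?M n) {E. {a} \<times> part_B n \<subseteq> E} = p n ^ n"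
      by (intro always_eventually allI ballI 1)
    show "\<forall>\<^sub>F n in sequentially. \<forall>a\<in>part_A n. \<forall>a'\<in>part_A n. a \<noteq> a' \<longrightarrow>
        measure_pmf.prob (?M n) {E. {a} \<times> part_B n \<subseteq> E \<and> {a'} \<times> part_B n \<subseteq> E} \<le> (p n ^ n)\<^sup>2 * (1 + 0)"
      by (intro always_eventually allI ballI impI) (rule order.trans[OF eq_refl[OF 2]], assumption+, simp)
  qed simp_all
  then show ?thesis by (rule aas_mono) simp
qed

text \<open>The factor \<open>1 / p\<^sup>2\<close> from \<open>prob_isolated_nonedge_pair\<close>
  plays the role of \<open>1 + \<rho>\<close>; the defect vanishes because \<open>p\<close> tends to
  1.\<close>

lemma aas_isolated_nonedges_concentrated:
  assumes p: "\<And>n. 0 \<le> p n" "\<And>n. p n \<le> 1" and p1: "p \<longlonglongrightarrow> 1"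
    and m: "filterlim (\<lambda>n. (real n)\<^sup>2 * (p n ^ (2 * (n - 1)) * (1 - p n))) at_top sequentially"
  shows "aas (\<lambda>n. random_bipartite n (p n))
    (\<lambda>n E. (real n)\<^sup>2 * (p n ^ (2 * (n - 1)) * (1 - p n)) / 2
       \<le> real (card {e \<in> part_A n \<times> part_B n. isolated_nonedge n E e}))"
proof -
  let ?M = "\<lambda>n. random_bipartite n (p n)"
  let ?\<mu> = "\<lambda>n. p n ^ (2 * (n - 1)) * (1 - p n)"
  have m': "real (card (part_A n \<times> part_B n)) = (real n)\<^sup>2" for n
    by (simp add: card_cartesian_product power2_eq_square)
  have pos: "\<forall>\<^sub>F n in sequentially. 0 < p n" using order_tendstoD(1)[OF p1, of 0] by simp
  have "aas ?M (\<lambda>n E. real (card (part_A n \<times> part_B n)) * ?\<mu> n / 2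
      \<le> real (card {e \<in> part_A n \<times> part_B n. isolated_nonedge n E e}) \<and>
    real (card {e \<in> part_A n \<times> part_B n. isolated_nonedge n E e})
      \<le> 3 / 2 * (real (card (part_A n \<times> part_B n)) * ?\<mu> n))"
  proof (rule aas_count_concentrated[where \<rho> = "\<lambda>n. 1 / (p n)\<^sup>2 - 1"])
    show "\<forall>\<^sub>F n in sequentially. \<forall>e\<in>part_A n \<times> part_B n.
        measure_pmf.prob (?M n) {E. isolated_nonedge n E e} = ?\<mu> n"
      by (intro always_eventually allI ballI prob_isolated_nonedge p)
    show "\<forall>\<^sub>F n in sequentially. \<forall>e\<in>part_A n \<times> part_B n. \<forall>e'\<in>part_A n \<times> part_B n. e \<noteq> e' \<longrightarrow>
        measure_pmf.prob (?M n) {E. isolated_nonedge n E e \<and> isolated_nonedge n E e'}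
          \<le> (?\<mu> n)\<^sup>2 * (1 + (1 / (p n)\<^sup>2 - 1))"
      using pos
    proof eventually_elim
      case (elim n)
      have "1 + (1 / (p n)\<^sup>2 - 1) = 1 / (p n)\<^sup>2" by simp
      show ?case
        unfolding \<open>1 + (1 / (p n)\<^sup>2 - 1) = 1 / (p n)\<^sup>2\<close>
        by (intro ballI impI prob_isolated_nonedge_pair[OF elim p(2)])
    qed
    show "\<forall>\<^sub>F n in sequentially. 0 \<le> 1 / (p n)\<^sup>2 - 1"
      using pos by eventually_elim (use p(2) in \<open>simp add: power_le_one\<close>)
    have "(\<lambda>n. 1 / (p n)\<^sup>2 - 1) \<longlonglongrightarrow> 1 / 1\<^sup>2 - 1" by (intro tendsto_intros p1) simp
    then show "(\<lambda>n. 1 / (p n)\<^sup>2 - 1) \<longlonglongrightarrow> 0" by simp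
    show "filterlim (\<lambda>n. real (card (part_A n \<times> part_B n)) * ?\<mu> n) at_top sequentially"
      using m by (simp only: m')
  qed simp
  then show ?thesis by (rule aas_mono) (simp only: m', simp)
qed

subsection \<open>Few non-edges\<close>

text \<open>Each full row saves one order in \<open>bip_dim_le\<close>, so many full rows keep the
  dimension away from \<open>n\<close>.\<close>

lemma card_deficient_rows:
  "card {a \<in> part_A n. \<exists>b\<in>part_B n. (a, b) \<notin> E} + card {a \<in> part_A n. {a} \<times> part_B n \<subseteq> E} = n"
proof -
  let ?D = "{a \<in> part_A n. \<exists>b\<in>part_B n. (a, b) \<notin> E}" and ?F = "{a \<in> part_A n. {a} \<times> part_B n \<subseteq> E}"
  have "card ?D + card ?F = card (?D \<union> ?F)"
    by (rule card_Un_disjoint[symmetric]) auto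
  also have "?D \<union> ?F = part_A n" by blast
  finally show ?thesis by simp
qed

lemma card_deficient_rows_le:
  "card {a \<in> part_A n. \<exists>b\<in>part_B n. (a, b) \<notin> E} \<le> card {e \<in> part_A n \<times> part_B n. e \<notin> E}"
proof -
  have "{a \<in> part_A n. \<exists>b\<in>part_B n. (a, b) \<notin> E} \<subseteq> fst ` {e \<in> part_A n \<times> part_B n. e \<notin> E}"
    by force
  then show ?thesis by (rule surj_card_le[rotated]) simp
qed

text \<open>The deterministic part: isolated non-edges bound the dimension from below, all non-edges
  from above, and full rows bound the gap to \<open>n\<close>. The two assumptions
  \<open>large\<close> absorb the additive 2 of \<open>bip_dim_le\<close>.\<close>

lemma bip_dim_bounds:
  assumes E: "E \<subseteq> part_A n \<times> part_B n"
    and iso: "(real n)\<^sup>2 * (p ^ (2 * (n - 1)) * q) / 2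
       \<le> real (card {e \<in> part_A n \<times> part_B n. isolated_nonedge n E e})"
    and non: "real (card {e \<in> part_A n \<times> part_B n. e \<notin> E}) \<le> 3 / 2 * ((real n)\<^sup>2 * q)"
    and row: "real n * p ^ n / 2 \<le> real (card {a \<in> part_A n. {a} \<times> part_B n \<subseteq> E})"
    and p: "0 < p" "p \<le> 1" "q \<ge> 0" and \<theta>: "0 < \<theta>" "\<theta> \<le> p ^ n"
    and large: "4 \<le> (real n)\<^sup>2 * q" "8 \<le> \<theta> * real n"
  shows "\<theta>\<^sup>2 / 2 * ((real n)\<^sup>2 * q) \<le> real (bip_dim n E)"
    and "real (bip_dim n E) \<le> 2 * ((real n)\<^sup>2 * q)"
    and "\<theta> / 4 * real n \<le> real n - real (bip_dim n E)"
proof -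
  have "\<theta>\<^sup>2 \<le> (p ^ n)\<^sup>2" using \<theta> by (intro power_mono) auto
  also have "\<dots> = p ^ (2 * n)" by (simp add: power_mult[symmetric] mult.commute)
  also have "\<dots> \<le> p ^ (2 * (n - 1))" using p by (intro power_decreasing) auto
  finally have "(real n)\<^sup>2 * (\<theta>\<^sup>2 * q) \<le> (real n)\<^sup>2 * (p ^ (2 * (n - 1)) * q)"
    using p by (intro mult_left_mono mult_right_mono) auto
  then show "\<theta>\<^sup>2 / 2 * ((real n)\<^sup>2 * q) \<le> real (bip_dim n E)"
    using iso of_nat_mono[OF isolated_nonedges_le_bip_dim[OF E], where ?'a = real]
    by (simp add: mult_ac)
  show "real (bip_dim n E) \<le> 2 * ((real n)\<^sup>2 * q)"
    using bip_dim_le[OF E] card_deficient_rows_le[of n E] non large(1) by linarith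
  have "\<theta> * real n \<le> real n * p ^ n" using mult_right_mono[OF \<theta>(2), of "real n"] by (simp add: mult.commute)
  then show "\<theta> / 4 * real n \<le> real n - real (bip_dim n E)"
    using bip_dim_le[OF E] card_deficient_rows[of n E] row large(2) by linarith
qed

lemma aas_bip_dim_few_nonedges:
  fixes p q :: "nat \<Rightarrow> real"
  assumes p: "\<And>n. p n \<in> {0..1}" and q: "\<And>n. q n = 1 - p n"
    and O: "q \<in> O(\<lambda>n. 1 / real n)" and \<omega>: "q \<in> \<omega>(\<lambda>n. 1 / (real n)\<^sup>2)"
  shows "\<exists>c C c'. c > 0 \<and> C > 0 \<and> c' > 0 \<and>
          aas (\<lambda>n. random_bipartite n (p n))
            (\<lambda>n E. c * ((real n)\<^sup>2 * q n) \<le> real (bip_dim n E) \<and>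
                   real (bip_dim n E) \<le> C * ((real n)\<^sup>2 * q n) \<and>
                   real n - real (bip_dim n E) \<ge> c' * real n)"
proof -
  have p01: "0 \<le> p n" "p n \<le> 1" and q0: "q n \<ge> 0" and qp: "1 - p n = q n" for n
    using p[of n] q[of n] by auto
  have N: "filterlim (\<lambda>n. (real n)\<^sup>2 * q n) at_top sequentially"
  proof -
    have "filterlim (\<lambda>n. norm (q n / (1 / (real n)\<^sup>2))) at_top sequentially"
      by (rule smallomegaD_filterlim_at_top_norm[OF \<omega>])
        (use eventually_gt_at_top[of 0] in \<open>eventually_elim, simp\<close>)
    also have "(\<lambda>n. norm (q n / (1 / (real n)\<^sup>2))) = (\<lambda>n. (real n)\<^sup>2 * q n)"
      using q0 by (simp add: fun_eq_iff abs_mult mult.commute)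
    finally show ?thesis .
  qed
  from O obtain K where K: "K > 0" "\<forall>\<^sub>F n in sequentially. norm (q n) \<le> K * norm (1 / real n)"
    by (elim landau_o.bigE)
  have qK: "\<forall>\<^sub>F n in sequentially. q n \<le> K / real n"
    using K(2) by eventually_elim (use q0 in simp)
  have "q \<longlonglongrightarrow> 0"
  proof (rule tendsto_sandwich[OF _ qK tendsto_const])
    show "\<forall>\<^sub>F n in sequentially. 0 \<le> q n" using q0 by simp
    show "(\<lambda>n. K / real n) \<longlonglongrightarrow> 0" by (rule lim_const_over_n)
  qed
  then have "(\<lambda>n. 1 - q n) \<longlonglongrightarrow> 1 - 0" by (intro tendsto_intros)
  then have p1: "p \<longlonglongrightarrow> 1" by (simp add: q)
  have ppos: "\<forall>\<^sub>F n in sequentially. 0 < p n" using order_tendstoD(1)[OF p1, of 0] by simp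
  \<comment> \<open>From \<open>q n \<le> K / real n\<close>, \<open>p n ^ n\<close> is at least
    \<open>(1 - K / real n) ^ n\<close>, which tends to \<open>exp (- K)\<close>; halving the limit
    gives a bound valid for all large \<open>n\<close>.\<close>
  define \<theta> where "\<theta> = exp (- K) / 2"
  have \<theta>: "\<theta> > 0" by (simp add: \<theta>_def)
  have "\<forall>\<^sub>F n in sequentially. \<theta> < (1 + (- K) / real n) ^ n"
    by (rule order_tendstoD(1)[OF tendsto_exp_limit_sequentially]) (simp add: \<theta>_def)
  \<comment> \<open>This makes the base \<open>1 - K / real n\<close> positive, as monotonicity of
    powers requires.\<close>
  moreover have "\<forall>\<^sub>F n in sequentially. K < real n"
    using filterlim_real_sequentially by (simp add: filterlim_at_top_dense)
  ultimately have \<theta>p: "\<forall>\<^sub>F n in sequentially. \<theta> \<le> p n ^ n"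
    using qK
  proof eventually_elim
    case (elim n)
    have "(1 + (- K) / real n) ^ n \<le> p n ^ n"
      using elim K(1) q[of n] by (intro power_mono) (auto simp: field_simps)
    with elim show ?case by simp
  qed
  have \<theta>n: "filterlim (\<lambda>n. \<theta> * real n) at_top sequentially"
    by (rule filterlim_tendsto_pos_mult_at_top[OF tendsto_const \<theta> filterlim_real_sequentially])
  have rows: "filterlim (\<lambda>n. real n * p n ^ n) at_top sequentially"
  proof (rule filterlim_at_top_mono[OF \<theta>n])
    show "\<forall>\<^sub>F n in sequentially. \<theta> * real n \<le> real n * p n ^ n"
      using \<theta>p
    proof eventually_elim
      case (elim n)
      then show ?case using mult_right_mono[OF elim, of "real n"] by (simp add: mult.commute)
    qed
  qed
  \<comment> \<open>The mean number of isolated edges of \<open>H\<close> is at least the fraction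
    \<open>\<theta>\<^sup>2\<close> of the mean number of all its edges, so it diverges too.\<close>
  have "filterlim (\<lambda>n. \<theta>\<^sup>2 * ((real n)\<^sup>2 * q n)) at_top sequentially"
    by (rule filterlim_tendsto_pos_mult_at_top[OF tendsto_const _ N]) (use \<theta> in simp)
  then have iso: "filterlim (\<lambda>n. (real n)\<^sup>2 * (p n ^ (2 * (n - 1)) * (1 - p n))) at_top sequentially"
  proof (rule filterlim_at_top_mono)
    show "\<forall>\<^sub>F n in sequentially. \<theta>\<^sup>2 * ((real n)\<^sup>2 * q n) \<le> (real n)\<^sup>2 * (p n ^ (2 * (n - 1)) * (1 - p n))"
      using \<theta>p
    proof eventually_elim
      case (elim n)
      have "\<theta>\<^sup>2 \<le> (p n ^ n)\<^sup>2" using \<theta> elim by (intro power_mono) auto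
      also have "\<dots> = p n ^ (2 * n)" by (simp add: power_mult[symmetric] mult.commute)
      also have "\<dots> \<le> p n ^ (2 * (n - 1))" using p01 by (intro power_decreasing) auto
      finally have "(real n)\<^sup>2 * (\<theta>\<^sup>2 * q n) \<le> (real n)\<^sup>2 * (p n ^ (2 * (n - 1)) * q n)"
        using q0 by (intro mult_left_mono mult_right_mono) auto
      then show ?case by (simp add: q mult_ac)
    qed
  qed
  have aas3: "aas (\<lambda>n. random_bipartite n (p n)) (\<lambda>n E.
      (real n)\<^sup>2 * (p n ^ (2 * (n - 1)) * (1 - p n)) / 2
        \<le> real (card {e \<in> part_A n \<times> part_B n. isolated_nonedge n E e}) \<and>
      real (card {e \<in> part_A n \<times> part_B n. e \<notin> E}) \<le> 3 / 2 * ((real n)\<^sup>2 * (1 - p n)) \<and>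
      real n * p n ^ n / 2 \<le> real (card {a \<in> part_A n. {a} \<times> part_B n \<subseteq> E}))"
    by (intro aas_conj aas_isolated_nonedges_concentrated aas_nonedges_concentrated
        aas_full_rows_concentrated p01 p1 iso rows) (use N in \<open>simp add: qp\<close>)
  have large1: "\<forall>\<^sub>F n in sequentially. 4 \<le> (real n)\<^sup>2 * q n" using N by (simp add: filterlim_at_top)
  have large2: "\<forall>\<^sub>F n in sequentially. 8 \<le> \<theta> * real n" using \<theta>n by (simp add: filterlim_at_top)
  have "aas (\<lambda>n. random_bipartite n (p n))
      (\<lambda>n E. \<theta>\<^sup>2 / 2 * ((real n)\<^sup>2 * q n) \<le> real (bip_dim n E) \<and>
             real (bip_dim n E) \<le> 2 * ((real n)\<^sup>2 * q n) \<and>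
             real n - real (bip_dim n E) \<ge> \<theta> / 4 * real n)"
  proof (rule aas_mono[OF aas3], use large1 large2 \<theta>p ppos in eventually_elim)
    case (elim n)
    show ?case
    proof (intro ballI impI, elim conjE, unfold qp)
      fix E
      assume "E \<in> set_pmf (random_bipartite n (p n))"
        "(real n)\<^sup>2 * (p n ^ (2 * (n - 1)) * q n) / 2
          \<le> real (card {e \<in> part_A n \<times> part_B n. isolated_nonedge n E e})"
        "real (card {e \<in> part_A n \<times> part_B n. e \<notin> E}) \<le> 3 / 2 * ((real n)\<^sup>2 * q n)"
        "real n * p n ^ n / 2 \<le> real (card {a \<in> part_A n. {a} \<times> part_B n \<subseteq> E})"
      from bip_dim_bounds[OF random_bipartite_subset[OF this(1)] this(2-4) elim(4) p01(2) q0 \<theta> elim(3,1,2)]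
      show "\<theta>\<^sup>2 / 2 * ((real n)\<^sup>2 * q n) \<le> real (bip_dim n E) \<and>
          real (bip_dim n E) \<le> 2 * ((real n)\<^sup>2 * q n) \<and>
          \<theta> / 4 * real n \<le> real n - real (bip_dim n E)"
        by blast
    qed
  qed
  then show ?thesis
    using \<theta> by (intro exI[of _ "\<theta>\<^sup>2 / 2"] exI[of _ 2] exI[of _ "\<theta> / 4"]) simp
qed

subsection \<open>Many non-edges\<close>

text \<open>Union bound: there are at most \<open>4 ^ n\<close> pairs \<open>(S, T)\<close>, and
  each rectangle is free of non-edges with probability \<open>p ^ (card S * card T)\<close>, where
  \<open>p \<le> exp (- (1 - p))\<close>.\<close>

lemma prob_empty_rectangle:
  assumes p: "0 \<le> p" "p \<le> 1" and s: "s \<ge> 0"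
  shows "measure_pmf.prob (random_bipartite n p)
      {E. \<not> (\<forall>S T. S \<subseteq> part_A n \<longrightarrow> T \<subseteq> part_B n \<longrightarrow> S \<times> T \<subseteq> E \<longrightarrow> real (card S) < s \<or> real (card T) < s)}
    \<le> 4 ^ n * exp (- (1 - p) * s\<^sup>2)"
proof -
  define R where "R = {(S, T). S \<subseteq> part_A n \<and> T \<subseteq> part_B n \<and> s \<le> real (card S) \<and> s \<le> real (card T)}"
  have sub: "R \<subseteq> Pow (part_A n) \<times> Pow (part_B n)" by (auto simp: R_def)
  then have fin: "finite R" by (rule finite_subset) simp
  have "card R \<le> card (Pow (part_A n) \<times> Pow (part_B n))" using sub by (intro card_mono) auto
  also have "\<dots> = 4 ^ n" by (simp add: card_cartesian_product card_Pow flip: power_mult_distrib)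
  finally have cardR: "real (card R) \<le> 4 ^ n" using of_nat_mono[of "card R" "4 ^ n", where ?'a = real] by simp
  have each: "measure_pmf.prob (random_bipartite n p) {E. fst r \<times> snd r \<subseteq> E} \<le> exp (- (1 - p) * s\<^sup>2)"
    if "r \<in> R" for r
  proof -
    obtain S T where r: "r = (S, T)" by (cases r)
    then have ST: "S \<subseteq> part_A n" "T \<subseteq> part_B n" "s \<le> real (card S)" "s \<le> real (card T)"
      using that by (auto simp: R_def)
    have "measure_pmf.prob (random_bipartite n p) {E. S \<times> T \<subseteq> E} = p ^ (card S * card T)"
      using ST by (subst prob_edges[OF p]) (auto simp: card_cartesian_product)
    also have "\<dots> \<le> exp (- (1 - p)) ^ (card S * card T)"
      using exp_ge_add_one_self[of "- (1 - p)"] p by (intro power_mono) auto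
    also have "\<dots> = exp (- (1 - p) * (real (card S) * real (card T)))"
      by (simp add: exp_of_nat_mult[symmetric] mult_ac)
    also have "\<dots> \<le> exp (- (1 - p) * s\<^sup>2)"
    proof -
      have "s\<^sup>2 \<le> real (card S) * real (card T)"
        unfolding power2_eq_square using ST s by (intro mult_mono) auto
      then have "(1 - p) * s\<^sup>2 \<le> (1 - p) * (real (card S) * real (card T))"
        using p by (intro mult_left_mono) auto
      then show ?thesis by (simp add: algebra_simps)
    qed
    finally show ?thesis by (simp add: r)
  qed
  have "{E. \<not> (\<forall>S T. S \<subseteq> part_A n \<longrightarrow> T \<subseteq> part_B n \<longrightarrow> S \<times> T \<subseteq> E \<longrightarrow> real (card S) < s \<or> real (card T) < s)}
      = (\<Union>r\<in>R. {E. fst r \<times> snd r \<subseteq> E})"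
  proof (rule set_eqI)
    fix E
    have "E \<in> (\<Union>r\<in>R. {E. fst r \<times> snd r \<subseteq> E}) \<longleftrightarrow> (\<exists>S T. (S, T) \<in> R \<and> S \<times> T \<subseteq> E)"
      by (simp only: UN_iff mem_Collect_eq Bex_def split_paired_Ex fst_conv snd_conv)
    also have "\<dots> \<longleftrightarrow> \<not> (\<forall>S T. S \<subseteq> part_A n \<longrightarrow> T \<subseteq> part_B n \<longrightarrow> S \<times> T \<subseteq> E \<longrightarrow> real (card S) < s \<or> real (card T) < s)"
      unfolding R_def by (simp add: not_less) blast
    finally show "E \<in> {E. \<not> (\<forall>S T. S \<subseteq> part_A n \<longrightarrow> T \<subseteq> part_B n \<longrightarrow> S \<times> T \<subseteq> E \<longrightarrow>
        real (card S) < s \<or> real (card T) < s)} \<longleftrightarrow> E \<in> (\<Union>r\<in>R. {E. fst r \<times> snd r \<subseteq> E})"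
      unfolding mem_Collect_eq by (rule sym)
  qed
  then have "measure_pmf.prob (random_bipartite n p)
      {E. \<not> (\<forall>S T. S \<subseteq> part_A n \<longrightarrow> T \<subseteq> part_B n \<longrightarrow> S \<times> T \<subseteq> E \<longrightarrow> real (card S) < s \<or> real (card T) < s)}
    \<le> (\<Sum>r\<in>R. measure_pmf.prob (random_bipartite n p) {E. fst r \<times> snd r \<subseteq> E})"
    using measure_UNION_le[OF fin, of "\<lambda>r. {E. fst r \<times> snd r \<subseteq> E}"] by simp
  also have "\<dots> \<le> real (card R) * exp (- (1 - p) * s\<^sup>2)"
    by (rule sum_bounded_above) (rule each)
  also have "\<dots> \<le> 4 ^ n * exp (- (1 - p) * s\<^sup>2)"
    using cardR by (intro mult_right_mono) auto
  finally show ?thesis .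
qed

text \<open>The factor 2 in \<open>s\<close> beats the \<open>4 ^ n\<close> choices of rectangles,
  since \<open>exp 2 > 4\<close>.\<close>

lemma aas_no_large_empty_rectangle:
  assumes p: "\<And>n. 0 \<le> p n" "\<And>n. p n \<le> 1"
    and s: "\<forall>\<^sub>F n in sequentially. 0 \<le> s n \<and> 2 * real n \<le> (1 - p n) * (s n)\<^sup>2"
  shows "aas (\<lambda>n. random_bipartite n (p n)) (\<lambda>n E. \<forall>S T. S \<subseteq> part_A n \<longrightarrow> T \<subseteq> part_B n \<longrightarrow>
    S \<times> T \<subseteq> E \<longrightarrow> real (card S) < s n \<or> real (card T) < s n)"
proof (rule aasI)
  show "\<forall>\<^sub>F n in sequentially. measure_pmf.prob (random_bipartite n (p n))
      {E. \<not> (\<forall>S T. S \<subseteq> part_A n \<longrightarrow> T \<subseteq> part_B n \<longrightarrow> S \<times> T \<subseteq> E \<longrightarrow> real (card S) < s n \<or> real (card T) < s n)}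
    \<le> (4 * exp (- 2)) ^ n"
    using s
  proof eventually_elim
    case (elim n)
    have "4 ^ n * exp (- (1 - p n) * (s n)\<^sup>2) \<le> 4 ^ n * exp (- (2 * real n))"
      using elim by (intro mult_left_mono) (auto simp: algebra_simps)
    also have "\<dots> = (4 * exp (- 2)) ^ n"
      by (simp add: power_mult_distrib exp_of_nat_mult[symmetric] mult.commute)
    finally show ?case using prob_empty_rectangle[OF p, of "s n" n n] elim by linarith
  qed
  have "4 < exp (2 :: real)" using exp_lower_Taylor_quadratic[of 2] by simp
  then have "4 * exp (- 2 :: real) < 1" by (simp add: exp_minus field_simps)
  then show "(\<lambda>n. (4 * exp (- 2 :: real)) ^ n) \<longlonglongrightarrow> 0" by (intro LIMSEQ_realpow_zero) auto
qed

section \<open>Counting 4-cycles of non-edges\<close>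

definition nonedge_C4s :: "nat \<Rightarrow> (nat \<times> nat) set \<Rightarrow> (nat \<times> nat \<times> nat \<times> nat) set" where
  "nonedge_C4s n E = {(a, a', b, b') \<in> part_A n \<times> part_A n \<times> part_B n \<times> part_B n. nonedge_C4 E a a' b b'}"

text \<open>First moment: of the \<open>n ^ 4\<close> quadruples, degenerate ones never count, and
  each other one needs four distinct non-edges.\<close>

lemma prob_nonedge_C4s:
  assumes p: "0 \<le> p" "p \<le> 1" and t: "t > 0"
  shows "measure_pmf.prob (random_bipartite n p) {E. t \<le> real (card (nonedge_C4s n E))}
    \<le> (real n * (1 - p)) ^ 4 / t"
proof -
  let ?I = "part_A n \<times> part_A n \<times> part_B n \<times> part_B n"
  have "measure_pmf.prob (random_bipartite n p) {E. t \<le> real (card {i \<in> ?I.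
      (\<lambda>(a, a', b, b'). nonedge_C4 E a a' b b') i})} \<le> real (card ?I) * (1 - p) ^ 4 / t"
  proof (rule pmf_count_markov[OF _ _ t])
    fix i assume "i \<in> ?I"
    then obtain a a' b b' where i: "i = (a, a', b, b')" "a \<in> part_A n" "a' \<in> part_A n" "b \<in> part_B n" "b' \<in> part_B n"
      by auto
    show "measure_pmf.prob (random_bipartite n p) {E. (\<lambda>(a, a', b, b'). nonedge_C4 E a a' b b') i} \<le> (1 - p) ^ 4"
    proof (cases "a \<noteq> a' \<and> b \<noteq> b'")
      case True
      then have "card ({a, a'} \<times> {b, b'}) = 4" by (simp add: card_cartesian_product)
      moreover have "{a, a'} \<times> {b, b'} \<subseteq> part_A n \<times> part_B n" using i by auto
      ultimately show ?thesis
        using prob_nonedges[OF p, of "{a, a'} \<times> {b, b'}" n] True i(1)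
        by (simp add: nonedge_C4_def power4_eq_xxxx mult.assoc)
    next
      case False
      then show ?thesis using p i(1) by (auto simp: nonedge_C4_def)
    qed
  qed simp
  moreover have "real (card ?I) = real n ^ 4"
    by (simp add: card_cartesian_product eval_nat_numeral)
  moreover have "{i \<in> ?I. (\<lambda>(a, a', b, b'). nonedge_C4 E a a' b b') i} = nonedge_C4s n E" for E
    by (auto simp: nonedge_C4s_def)
  ultimately show ?thesis by (simp add: power_mult_distrib)
qed

text \<open>Here \<open>n * q\<close> is at most \<open>n powr (1 / 7)\<close>, so the mean is at
  most \<open>n powr (4 / 7)\<close>. The threshold exponent 5/7 lies strictly between 4/7 and 1:
  Markov's bound vanishes and the count is still o(n).\<close>

lemma aas_few_nonedge_C4s:
  assumes p: "\<And>n. 0 \<le> p n" "\<And>n. p n \<le> 1"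
    and q: "\<forall>\<^sub>F n in sequentially. 1 - p n \<le> real n powr (- 1 + 1 / 7)"
  shows "aas (\<lambda>n. random_bipartite n (p n)) (\<lambda>n E. real (card (nonedge_C4s n E)) < real n powr (5 / 7))"
proof (rule aasI)
  show "\<forall>\<^sub>F n in sequentially. measure_pmf.prob (random_bipartite n (p n))
      {E. \<not> real (card (nonedge_C4s n E)) < real n powr (5 / 7)} \<le> real n powr (- (1 / 7))"
    using q eventually_gt_at_top[of 0]
  proof eventually_elim
    case (elim n)
    have "real n * (1 - p n) \<le> real n powr 1 * real n powr (- 1 + 1 / 7)"
      using elim by (simp add: mult_left_mono)
    also have "\<dots> = real n powr (1 / 7)" by (simp only: powr_add[symmetric]) simp
    finally have "(real n * (1 - p n)) ^ 4 \<le> (real n powr (1 / 7)) ^ 4"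
      using p by (intro power_mono) auto
    also have "\<dots> = real n powr (4 / 7)"
      using elim by (simp add: powr_power)
    finally have "(real n * (1 - p n)) ^ 4 / real n powr (5 / 7) \<le> real n powr (4 / 7) / real n powr (5 / 7)"
      by (rule divide_right_mono) simp
    also have "\<dots> = real n powr (- (1 / 7))" by (simp flip: powr_diff)
    finally show ?case
      using prob_nonedge_C4s[OF p, of "real n powr (5 / 7)" n n] elim by (simp add: not_less)
  qed
  show "(\<lambda>n. real n powr (- (1 / 7))) \<longlonglongrightarrow> 0"
    by (rule tendsto_neg_powr[OF _ filterlim_real_sequentially]) simp
qed

text \<open>The empty rectangle left by an optimal realizer has both sides at least \<open>n\<close>
  minus the dimension and the number of quadruples, yet one side is below \<open>\<eta> * n\<close>.
  This bounds \<open>\<delta>\<close> above; since the dimension may exceed \<open>n\<close> by up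
  to 2, \<open>\<delta>\<close> can be negative, which costs \<open>2 / n\<close>.\<close>

lemma bip_dim_near_n:
  assumes E: "E \<subseteq> part_A n \<times> part_B n" and n: "n > 0" and \<eta>: "\<eta> \<ge> 0"
    and rect: "\<forall>S T. S \<subseteq> part_A n \<longrightarrow> T \<subseteq> part_B n \<longrightarrow> S \<times> T \<subseteq> E \<longrightarrow>
      real (card S) < \<eta> * real n \<or> real (card T) < \<eta> * real n"
    and C4: "real (card (nonedge_C4s n E)) < real n powr (5 / 7)"
  shows "\<exists>\<delta>. \<bar>\<delta>\<bar> \<le> real n powr (- (2 / 7)) + \<eta> + 2 / real n \<and> real (bip_dim n E) = (1 - \<delta>) * real n"
proof -
  define \<delta> where "\<delta> = 1 - real (bip_dim n E) / real n"
  obtain S T where ST: "S \<subseteq> part_A n" "T \<subseteq> part_B n" "S \<times> T \<subseteq> E"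
    "n \<le> card S + bip_dim n E + card (nonedge_C4s n E)"
    "n \<le> card T + bip_dim n E + card (nonedge_C4s n E)"
    unfolding nonedge_C4s_def by (rule bip_dim_large_empty_rectangle[OF E])
  have "real n * real n powr (- (2 / 7)) = real n powr (1 + - (2 / 7))"
    unfolding powr_add using n by simp
  then have pw: "real n powr (5 / 7) = real n powr (- (2 / 7)) * real n" by (simp add: mult.commute)
  have "real (card S) < \<eta> * real n \<or> real (card T) < \<eta> * real n" using rect ST(1-3) by blast
  then have "real n \<le> \<eta> * real n + real (bip_dim n E) + real n powr (- (2 / 7)) * real n"
    using ST(4,5) C4 unfolding pw by linarith
  then have 1: "\<delta> \<le> real n powr (- (2 / 7)) + \<eta>"
    using n by (simp add: \<delta>_def field_simps)
  have "bip_dim n E \<le> n + 2"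
    using bip_dim_le[OF E] card_deficient_rows[of n E] by linarith
  then have "real (bip_dim n E) / real n \<le> (real n + 2) / real n"
    by (intro divide_right_mono) linarith+
  then have 2: "- \<delta> \<le> 2 / real n"
    using n by (simp add: \<delta>_def add_divide_distrib)
  have "\<bar>\<delta>\<bar> \<le> real n powr (- (2 / 7)) + \<eta> + 2 / real n"
    using 1 2 \<eta> by (auto simp: abs_le_iff intro: add_increasing add_increasing2)
  moreover have "real (bip_dim n E) = (1 - \<delta>) * real n" using n by (simp add: \<delta>_def)
  ultimately show ?thesis by blast
qed

lemma aas_bip_dim_many_nonedges:
  fixes p q :: "nat \<Rightarrow> real"
  assumes p: "\<And>n. p n \<in> {0..1}" and q: "\<And>n. q n = 1 - p n"
    and \<omega>: "q \<in> \<omega>(\<lambda>n. 1 / real n)"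
    and le: "\<forall>\<^sub>F n in sequentially. q n \<le> real n powr (- 1 + 1 / 7)"
  shows "\<exists>\<epsilon> :: nat \<Rightarrow> real. \<epsilon> \<longlonglongrightarrow> 0 \<and>
          aas (\<lambda>n. random_bipartite n (p n))
            (\<lambda>n E. \<exists>\<delta>. \<bar>\<delta>\<bar> \<le> \<epsilon> n \<and> real (bip_dim n E) = (1 - \<delta>) * real n)"
proof -
  have p01: "0 \<le> p n" "p n \<le> 1" and q0: "q n \<ge> 0" for n
    using p[of n] q[of n] by auto
  have N: "filterlim (\<lambda>n. real n * q n) at_top sequentially"
  proof -
    have "filterlim (\<lambda>n. norm (q n / (1 / real n))) at_top sequentially"
      by (rule smallomegaD_filterlim_at_top_norm[OF \<omega>])
        (use eventually_gt_at_top[of 0] in \<open>eventually_elim, simp\<close>)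
    also have "(\<lambda>n. norm (q n / (1 / real n))) = (\<lambda>n. real n * q n)"
      using q0 by (simp add: fun_eq_iff abs_mult mult.commute)
    finally show ?thesis .
  qed
  then have Npos: "\<forall>\<^sub>F n in sequentially. 0 < real n * q n" by (simp add: filterlim_at_top_dense)
  \<comment> \<open>Chosen so that \<open>q n * (\<eta> n * real n)\<^sup>2 = 2 * real n\<close>,
    the threshold of \<open>aas_no_large_empty_rectangle\<close>. As \<open>real n * q n\<close>
    diverges, \<open>\<eta>\<close> tends to 0; where that product is 0, division makes
    \<open>\<eta> n\<close> equal to 0.\<close>
  define \<eta> where "\<eta> n = sqrt (2 / (real n * q n))" for n
  have \<eta>0: "\<eta> n \<ge> 0" for n using q0 by (simp add: \<eta>_def)
  have "\<eta> \<longlonglongrightarrow> sqrt 0"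
    unfolding \<eta>_def by (intro tendsto_real_sqrt real_tendsto_divide_at_top[OF tendsto_const N])
  then have \<eta>: "\<eta> \<longlonglongrightarrow> 0" by simp
  have "\<forall>\<^sub>F n in sequentially. 0 \<le> \<eta> n * real n \<and> 2 * real n \<le> (1 - p n) * (\<eta> n * real n)\<^sup>2"
    using Npos
  proof eventually_elim
    case (elim n)
    then have "(\<eta> n)\<^sup>2 = 2 / (real n * q n)" by (simp add: \<eta>_def)
    then have "(1 - p n) * (\<eta> n * real n)\<^sup>2 = q n * (2 / (real n * q n) * (real n)\<^sup>2)"
      by (simp add: q power_mult_distrib)
    also have "\<dots> = 2 * real n" using elim by (auto simp: field_simps power2_eq_square)
    finally show ?case using \<eta>0 by simp
  qed
  then have rect: "aas (\<lambda>n. random_bipartite n (p n)) (\<lambda>n E. \<forall>S T. S \<subseteq> part_A n \<longrightarrow> T \<subseteq> part_B n \<longrightarrow>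
      S \<times> T \<subseteq> E \<longrightarrow> real (card S) < \<eta> n * real n \<or> real (card T) < \<eta> n * real n)"
    by (rule aas_no_large_empty_rectangle[OF p01])
  have C4: "aas (\<lambda>n. random_bipartite n (p n)) (\<lambda>n E. real (card (nonedge_C4s n E)) < real n powr (5 / 7))"
    by (rule aas_few_nonedge_C4s[OF p01]) (use le in \<open>simp add: q\<close>)
  \<comment> \<open>The three losses: vertices deleted with 4-cycles, the side of the empty
    rectangle, and the additive 2 of the upper bound.\<close>
  define \<epsilon> where "\<epsilon> n = real n powr (- (2 / 7)) + \<eta> n + 2 / real n" for n
  have "(\<lambda>n. real n powr (- (2 / 7))) \<longlonglongrightarrow> 0"
    by (rule tendsto_neg_powr[OF _ filterlim_real_sequentially]) simp
  then have "\<epsilon> \<longlonglongrightarrow> 0 + 0 + 0"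
    unfolding \<epsilon>_def by (intro tendsto_add \<eta> lim_const_over_n)
  then have "\<epsilon> \<longlonglongrightarrow> 0" by simp
  moreover have "aas (\<lambda>n. random_bipartite n (p n))
      (\<lambda>n E. \<exists>\<delta>. \<bar>\<delta>\<bar> \<le> \<epsilon> n \<and> real (bip_dim n E) = (1 - \<delta>) * real n)"
  proof (rule aas_mono[OF aas_conj[OF rect C4]])
    show "\<forall>\<^sub>F n in sequentially. \<forall>E\<in>set_pmf (random_bipartite n (p n)).
        (\<forall>S T. S \<subseteq> part_A n \<longrightarrow> T \<subseteq> part_B n \<longrightarrow> S \<times> T \<subseteq> E \<longrightarrow>
          real (card S) < \<eta> n * real n \<or> real (card T) < \<eta> n * real n) \<and>
        real (card (nonedge_C4s n E)) < real n powr (5 / 7) \<longrightarrow>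
        (\<exists>\<delta>. \<bar>\<delta>\<bar> \<le> \<epsilon> n \<and> real (bip_dim n E) = (1 - \<delta>) * real n)"
      using eventually_gt_at_top[of 0]
    proof eventually_elim
      case (elim n)
      show ?case
        unfolding \<epsilon>_def
        using bip_dim_near_n[OF random_bipartite_subset elim \<eta>0] by (intro ballI impI) simp
    qed
  qed
  ultimately show ?thesis by blast
qed

text \<open>The Landau bounds on a random quantity are read with deterministic constants, and o(1)
  as a deterministic null sequence \<open>\<epsilon>\<close> bounding the random deviation
  \<open>\<delta>\<close>.\<close>

theorem theorem1p9:
  fixes p q :: "nat \<Rightarrow> real"
  assumes p: "\<And>n. p n \<in> {0..1}" and q: "\<And>n. q n = 1 - p n"
  shows
    "(q \<in> O(\<lambda>n. 1 / real n) \<longrightarrow> q \<in> \<omega>(\<lambda>n. 1 / (real n)\<^sup>2) \<longrightarrow>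
       (\<exists>c C c'. c > 0 \<and> C > 0 \<and> c' > 0 \<and>
          aas (\<lambda>n. random_bipartite n (p n))
            (\<lambda>n E. c * ((real n)\<^sup>2 * q n) \<le> real (bip_dim n E) \<and>
                   real (bip_dim n E) \<le> C * ((real n)\<^sup>2 * q n) \<and>
                   real n - real (bip_dim n E) \<ge> c' * real n))) \<and>
     (q \<in> \<omega>(\<lambda>n. 1 / real n) \<longrightarrow> (\<forall>\<^sub>F n in sequentially. q n \<le> real n powr (-1 + 1 / 7)) \<longrightarrow>
       (\<exists>\<epsilon> :: nat \<Rightarrow> real. \<epsilon> \<longlonglongrightarrow> 0 \<and>
          aas (\<lambda>n. random_bipartite n (p n))
            (\<lambda>n E. \<exists>\<delta>. \<bar>\<delta>\<bar> \<le> \<epsilon> n \<and> real (bip_dim n E) = (1 - \<delta>) * real n)))"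
  using aas_bip_dim_few_nonedges[of p q, OF p q] aas_bip_dim_many_nonedges[of p q, OF p q]
  by (intro conjI impI)

end
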